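(* Let $G$ be a group, $R$ a $G$-graded commutative ring with identity and $M$ a graded $R$-module. Let $S\subseteq h(R)$ be a multiplicatively closed subset of $R$ and $N$ a graded primary-like submodule of $M$ satisfying the gr-primeful property such that $S\cap\mathrm{Gr}((N:_RM))=\emptyset$. Then $S^{-1}N$ is a graded primary-like submodule of the $S^{-1}R$-module $S^{-1}M$ and $S^{-1}N$ satisfies the gr-primeful property.
   Context: All rings are commutative with identity and all modules are unitary. $R=\bigoplus_{g\in G}R_g$ is $G$-graded with $R_gR_h\subseteq R_{gh}$; a graded $R$-module is $M=\bigoplus_{g\in G}M_g$ with $R_gM_h\subseteq M_{gh}$; $h(R)=\bigcup_g R_g$ and $h(M)=\bigcup_g M_g$. An ideal $I$ (submodule $N$) is graded if $I=\bigoplus_g(I\cap R_g)$ (resp. $N=\bigoplus_g(N\cap M_g)$). $(N:_R M)=\{r\in R: rM\subseteq N\}$. A proper graded ideal $p$ of $R$ is graded prime if for $r,s\in h(R)$, $rs\in p$ implies $r\in p$ or $s\in p$. For a graded ideal $I$, $\mathrm{Gr}(I)$ is the set of all $x=\sum_{g}x_g\in R$ such that for each $g\in G$ there is $n_g\in\mathbb{Z}^+$ with $x_g^{n_g}\in I$. A proper graded submodule $P$ of $M$ is graded prime if whenever $r\in h(R)$, $m\in h(M)$ and $rm\in P$, then $r\in(P:_RM)$ or $m\in P$. The graded radical $\mathrm{Gr}_M(N)$ of a graded submodule $N$ is the intersection of all graded prime submodules of $M$ containing $N$, with $\mathrm{Gr}_M(N)=M$ if there are none. A proper graded submodule $N$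 of $M$ is graded primary-like if whenever $r\in h(R)$ and $m\in h(M)$ with $rm\in N$, then either $r\in(N:_RM)$ or $m\in\mathrm{Gr}_M(N)$. A graded submodule $N$ of $M$ satisfies the gr-primeful property if for each graded prime ideal $p$ of $R$ with $(N:_RM)\subseteq p$ there is a graded prime submodule $P$ of $M$ containing $N$ with $(P:_RM)=p$. For a multiplicatively closed $S\subseteq h(R)$, $S^{-1}R$ is $G$-graded by $(S^{-1}R)_g=\{r/s: r\in h(R),\ s\in S,\ g=(\deg s)^{-1}(\deg r)\}$ and $S^{-1}M$ is a graded $S^{-1}R$-module with $(S^{-1}M)_g=\{m/s: m\in h(M),\ s\in S,\ g=(\deg s)^{-1}(\deg m)\}$. For a graded submodule $N$ of $M$, $S^{-1}N=\{m/s: m\in N,\ s\in S\}\subseteq S^{-1}M$. The notions above are applied to $S^{-1}M$ over $S^{-1}R$ with these gradings. *)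

theory Defs
  imports "HOL-Algebra.Module" "HOL-Algebra.Ideal"
begin

section \<open>Graded rings and modules\<close>

definition fin_supp_families :: "('a, 'x) ring_scheme \<Rightarrow> 'i set \<Rightarrow> ('i \<Rightarrow> 'a set) \<Rightarrow> ('i \<Rightarrow> 'a) set"
  where "fin_supp_families A I B =
    {f \<in> (\<Pi>\<^sub>E i\<in>I. B i). finite {i \<in> I. f i \<noteq> \<zero>\<^bsub>A\<^esub>}}"

text \<open>\<open>finsum\<close> is only meaningful over finite sets, so the sum is taken over the support.\<close>

definition family_sum :: "('a, 'x) ring_scheme \<Rightarrow> 'i set \<Rightarrow> ('i \<Rightarrow> 'a) \<Rightarrow> 'a"
  where "family_sum A I f = finsum A f {i \<in> I. f i \<noteq> \<zero>\<^bsub>A\<^esub>}"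

definition is_direct_sum ::
    "('a, 'x) ring_scheme \<Rightarrow> 'i set \<Rightarrow> ('i \<Rightarrow> 'a set) \<Rightarrow> 'a set \<Rightarrow> bool"
  where "is_direct_sum A I B C \<longleftrightarrow>
    (\<forall>i\<in>I. additive_subgroup (B i) A) \<and>
    bij_betw (family_sum A I) (fin_supp_families A I B) C"

locale graded_ring = G?: group G + R?: cring R
  for G :: "('g, 'x) monoid_scheme" (structure) and R :: "('r, 'y) ring_scheme" (structure) +
  fixes \<R> :: "'g \<Rightarrow> 'r set"
  assumes ring_direct_sum: "is_direct_sum R (carrier G) \<R> (carrier R)"
    and mult_degree: "\<lbrakk>g \<in> carrier G; h \<in> carrier G; r \<in> \<R> g; s \<in> \<R> h\<rbrakk>
      \<Longrightarrow> r \<otimes>\<^bsub>R\<^esub> s \<in> \<R> (g \<otimes>\<^bsub>G\<^esub> h)"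

locale graded_module = graded_ring G R \<R> + module R M
  for G :: "('g, 'x) monoid_scheme" (structure) and R :: "('r, 'y) ring_scheme" (structure)
    and \<R> :: "'g \<Rightarrow> 'r set" and M :: "('r, 'm, 'z) module_scheme" (structure) +
  fixes \<M> :: "'g \<Rightarrow> 'm set"
  assumes module_direct_sum: "is_direct_sum M (carrier G) \<M> (carrier M)"
    and smult_degree: "\<lbrakk>g \<in> carrier G; h \<in> carrier G; r \<in> \<R> g; m \<in> \<M> h\<rbrakk>
      \<Longrightarrow> r \<odot>\<^bsub>M\<^esub> m \<in> \<M> (g \<otimes>\<^bsub>G\<^esub> h)"

definition homogeneous :: "('g, 'x) monoid_scheme \<Rightarrow> ('g \<Rightarrow> 'a set) \<Rightarrow> 'a set"
  where "homogeneous G \<A> = (\<Union>g\<in>carrier G. \<A> g)"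


section \<open>Graded ideals and submodules\<close>

definition graded_ideal ::
    "('g, 'x) monoid_scheme \<Rightarrow> ('r, 'y) ring_scheme \<Rightarrow> ('g \<Rightarrow> 'r set) \<Rightarrow> 'r set \<Rightarrow> bool"
  where "graded_ideal G R \<R> I \<longleftrightarrow>
    ideal I R \<and> is_direct_sum R (carrier G) (\<lambda>g. I \<inter> \<R> g) I"

definition graded_prime_ideal ::
    "('g, 'x) monoid_scheme \<Rightarrow> ('r, 'y) ring_scheme \<Rightarrow> ('g \<Rightarrow> 'r set) \<Rightarrow> 'r set \<Rightarrow> bool"
  where "graded_prime_ideal G R \<R> p \<longleftrightarrow>
    graded_ideal G R \<R> p \<and> p \<noteq> carrier R \<and>
    (\<forall>r\<in>homogeneous G \<R>. \<forall>s\<in>homogeneous G \<R>. r \<otimes>\<^bsub>R\<^esub> s \<in> p \<longrightarrow> r \<in> p \<or> s \<in> p)"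

definition graded_ideal_radical ::
    "('g, 'x) monoid_scheme \<Rightarrow> ('r, 'y) ring_scheme \<Rightarrow> ('g \<Rightarrow> 'r set) \<Rightarrow> 'r set \<Rightarrow> 'r set"
  where "graded_ideal_radical G R \<R> I =
    {family_sum R (carrier G) x | x. x \<in> fin_supp_families R (carrier G) \<R> \<and>
      (\<forall>g\<in>carrier G. \<exists>n::nat. n > 0 \<and> x g [^]\<^bsub>R\<^esub> n \<in> I)}"

definition module_colon ::
    "('r, 'y) ring_scheme \<Rightarrow> ('r, 'm, 'z) module_scheme \<Rightarrow> 'm set \<Rightarrow> 'r set"
  where "module_colon R M N = {r \<in> carrier R. \<forall>m\<in>carrier M. r \<odot>\<^bsub>M\<^esub> m \<in> N}"

definition graded_submodule ::
    "('g, 'x) monoid_scheme \<Rightarrow> ('r, 'y) ring_scheme \<Rightarrow> ('r, 'm, 'z) module_scheme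
      \<Rightarrow> ('g \<Rightarrow> 'm set) \<Rightarrow> 'm set \<Rightarrow> bool"
  where "graded_submodule G R M \<M> N \<longleftrightarrow>
    submodule N R M \<and> is_direct_sum M (carrier G) (\<lambda>g. N \<inter> \<M> g) N"

definition graded_prime_submodule ::
    "('g, 'x) monoid_scheme \<Rightarrow> ('r, 'y) ring_scheme \<Rightarrow> ('g \<Rightarrow> 'r set)
      \<Rightarrow> ('r, 'm, 'z) module_scheme \<Rightarrow> ('g \<Rightarrow> 'm set) \<Rightarrow> 'm set \<Rightarrow> bool"
  where "graded_prime_submodule G R \<R> M \<M> P \<longleftrightarrow>
    graded_submodule G R M \<M> P \<and> P \<noteq> carrier M \<and>
    (\<forall>r\<in>homogeneous G \<R>. \<forall>m\<in>homogeneous G \<M>.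
      r \<odot>\<^bsub>M\<^esub> m \<in> P \<longrightarrow> r \<in> module_colon R M P \<or> m \<in> P)"

definition graded_module_radical ::
    "('g, 'x) monoid_scheme \<Rightarrow> ('r, 'y) ring_scheme \<Rightarrow> ('g \<Rightarrow> 'r set)
      \<Rightarrow> ('r, 'm, 'z) module_scheme \<Rightarrow> ('g \<Rightarrow> 'm set) \<Rightarrow> 'm set \<Rightarrow> 'm set"
  where "graded_module_radical G R \<R> M \<M> N =
    (if \<exists>P. graded_prime_submodule G R \<R> M \<M> P \<and> N \<subseteq> P
     then \<Inter> {P. graded_prime_submodule G R \<R> M \<M> P \<and> N \<subseteq> P}
     else carrier M)"

definition graded_primary_like_submodule ::
    "('g, 'x) monoid_scheme \<Rightarrow> ('r, 'y) ring_scheme \<Rightarrow> ('g \<Rightarrow> 'r set)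
      \<Rightarrow> ('r, 'm, 'z) module_scheme \<Rightarrow> ('g \<Rightarrow> 'm set) \<Rightarrow> 'm set \<Rightarrow> bool"
  where "graded_primary_like_submodule G R \<R> M \<M> N \<longleftrightarrow>
    graded_submodule G R M \<M> N \<and> N \<noteq> carrier M \<and>
    (\<forall>r\<in>homogeneous G \<R>. \<forall>m\<in>homogeneous G \<M>.
      r \<odot>\<^bsub>M\<^esub> m \<in> N \<longrightarrow> r \<in> module_colon R M N \<or> m \<in> graded_module_radical G R \<R> M \<M> N)"

definition gr_primeful ::
    "('g, 'x) monoid_scheme \<Rightarrow> ('r, 'y) ring_scheme \<Rightarrow> ('g \<Rightarrow> 'r set)
      \<Rightarrow> ('r, 'm, 'z) module_scheme \<Rightarrow> ('g \<Rightarrow> 'm set) \<Rightarrow> 'm set \<Rightarrow> bool"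
  where "gr_primeful G R \<R> M \<M> N \<longleftrightarrow>
    (\<forall>p. graded_prime_ideal G R \<R> p \<and> module_colon R M N \<subseteq> p \<longrightarrow>
      (\<exists>P. graded_prime_submodule G R \<R> M \<M> P \<and> N \<subseteq> P \<and> module_colon R M P = p))"


section \<open>Localization\<close>

definition ring_frac_rel :: "('r, 'y) ring_scheme \<Rightarrow> 'r set \<Rightarrow> (('r \<times> 'r) \<times> ('r \<times> 'r)) set"
  where "ring_frac_rel R S =
    {((a, s), (b, t)). a \<in> carrier R \<and> b \<in> carrier R \<and> s \<in> S \<and> t \<in> S \<and>
      (\<exists>u\<in>S. u \<otimes>\<^bsub>R\<^esub> (t \<otimes>\<^bsub>R\<^esub> a) = u \<otimes>\<^bsub>R\<^esub> (s \<otimes>\<^bsub>R\<^esub> b))}"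

definition ring_frac :: "('r, 'y) ring_scheme \<Rightarrow> 'r set \<Rightarrow> 'r \<Rightarrow> 'r \<Rightarrow> ('r \<times> 'r) set"
  where "ring_frac R S a s = ring_frac_rel R S `` {(a, s)}"

text \<open>The operations below are unions over all representatives; by independence of the
  representatives each union is a single class.\<close>

definition loc_ring :: "('r, 'y) ring_scheme \<Rightarrow> 'r set \<Rightarrow> ('r \<times> 'r) set ring"
  where "loc_ring R S =
    \<lparr>carrier = (carrier R \<times> S) // ring_frac_rel R S,
     mult = (\<lambda>U V. \<Union>(a, s)\<in>U. \<Union>(b, t)\<in>V. ring_frac R S (a \<otimes>\<^bsub>R\<^esub> b) (s \<otimes>\<^bsub>R\<^esub> t)),
     one = ring_frac R S \<one>\<^bsub>R\<^esub> \<one>\<^bsub>R\<^esub>,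
     zero = ring_frac R S \<zero>\<^bsub>R\<^esub> \<one>\<^bsub>R\<^esub>,
     add = (\<lambda>U V. \<Union>(a, s)\<in>U. \<Union>(b, t)\<in>V.
       ring_frac R S (t \<otimes>\<^bsub>R\<^esub> a \<oplus>\<^bsub>R\<^esub> s \<otimes>\<^bsub>R\<^esub> b) (s \<otimes>\<^bsub>R\<^esub> t))\<rparr>"

definition module_frac_rel ::
    "'r set \<Rightarrow> ('r, 'm, 'z) module_scheme \<Rightarrow> (('m \<times> 'r) \<times> ('m \<times> 'r)) set"
  where "module_frac_rel S M =
    {((m, s), (n, t)). m \<in> carrier M \<and> n \<in> carrier M \<and> s \<in> S \<and> t \<in> S \<and>
      (\<exists>u\<in>S. u \<odot>\<^bsub>M\<^esub> (t \<odot>\<^bsub>M\<^esub> m) = u \<odot>\<^bsub>M\<^esub> (s \<odot>\<^bsub>M\<^esub> n))}"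

definition module_frac :: "'r set \<Rightarrow> ('r, 'm, 'z) module_scheme \<Rightarrow> 'm \<Rightarrow> 'r \<Rightarrow> ('m \<times> 'r) set"
  where "module_frac S M m s = module_frac_rel S M `` {(m, s)}"

text \<open>The record type \<open>module\<close> inherits the fields \<open>mult\<close> and \<open>one\<close> from \<open>ring\<close>,
  which play no role for modules.\<close>

definition loc_module ::
    "('r, 'y) ring_scheme \<Rightarrow> 'r set \<Rightarrow> ('r, 'm, 'z) module_scheme
      \<Rightarrow> (('r \<times> 'r) set, ('m \<times> 'r) set) module"
  where "loc_module R S M =
    \<lparr>carrier = (carrier M \<times> S) // module_frac_rel S M,
     mult = undefined,
     one = undefined,
     zero = module_frac S M \<zero>\<^bsub>M\<^esub> \<one>\<^bsub>R\<^esub>,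
     add = (\<lambda>U V. \<Union>(m, s)\<in>U. \<Union>(n, t)\<in>V.
       module_frac S M (t \<odot>\<^bsub>M\<^esub> m \<oplus>\<^bsub>M\<^esub> s \<odot>\<^bsub>M\<^esub> n) (s \<otimes>\<^bsub>R\<^esub> t)),
     smult = (\<lambda>U V. \<Union>(a, s)\<in>U. \<Union>(m, t)\<in>V. module_frac S M (a \<odot>\<^bsub>M\<^esub> m) (s \<otimes>\<^bsub>R\<^esub> t))\<rparr>"

definition loc_submodule :: "'r set \<Rightarrow> ('r, 'm, 'z) module_scheme \<Rightarrow> 'm set \<Rightarrow> ('m \<times> 'r) set set"
  where "loc_submodule S M N = {module_frac S M m s | m s. m \<in> N \<and> s \<in> S}"

text \<open>In the two gradings, \<open>h\<close> and \<open>k\<close> are degrees of the numerator and of the denominator.  As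
  \<open>0\<close> lies in every component, \<open>0/s\<close> lies in every component.\<close>

definition loc_ring_grading ::
    "('g, 'x) monoid_scheme \<Rightarrow> ('r, 'y) ring_scheme \<Rightarrow> ('g \<Rightarrow> 'r set) \<Rightarrow> 'r set
      \<Rightarrow> 'g \<Rightarrow> ('r \<times> 'r) set set"
  where "loc_ring_grading G R \<R> S g =
    {ring_frac R S r s | r s h k. h \<in> carrier G \<and> k \<in> carrier G \<and> r \<in> \<R> h \<and> s \<in> S \<inter> \<R> k \<and>
      g = inv\<^bsub>G\<^esub> k \<otimes>\<^bsub>G\<^esub> h}"

definition loc_module_grading ::
    "('g, 'x) monoid_scheme \<Rightarrow> ('g \<Rightarrow> 'r set) \<Rightarrow> 'r set \<Rightarrow> ('r, 'm, 'z) module_scheme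
      \<Rightarrow> ('g \<Rightarrow> 'm set) \<Rightarrow> 'g \<Rightarrow> ('m \<times> 'r) set set"
  where "loc_module_grading G \<R> S M \<M> g =
    {module_frac S M m s | m s h k. h \<in> carrier G \<and> k \<in> carrier G \<and> m \<in> \<M> h \<and> s \<in> S \<inter> \<R> k \<and>
      g = inv\<^bsub>G\<^esub> k \<otimes>\<^bsub>G\<^esub> h}"

end

theory Submission
  imports "HOL-Algebra.Ring_Divisibility" Defs
begin

text \<open>The proof clears denominators: \<open>m/s\<close> lies in \<open>S\<inverse>N\<close> if and only if \<open>um \<in> N\<close> for some
  \<open>u \<in> S\<close>.  Hence if a product \<open>(r/s)(m/t)\<close> of homogeneous fractions lies in \<open>S\<inverse>N\<close>, then
  \<open>(ur)m \<in> N\<close>, and the hypothesis on \<open>N\<close> gives \<open>ur \<in> (N : M)\<close>, so that \<open>r/s = (ur)/(us)\<close>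
  multiplies \<open>S\<inverse>M\<close> into \<open>S\<inverse>N\<close>, or \<open>m \<in> Gr\<^sub>M(N)\<close>.  In the second case \<open>m/t\<close> lies in the
  graded radical of \<open>S\<inverse>N\<close>, because the inverse image under \<open>m \<mapsto> m/1\<close> of a graded prime submodule
  over \<open>S\<inverse>N\<close> is a graded prime submodule over \<open>N\<close> (\<open>frac_mem_module_radical\<close>).

  The primeful property and properness come from graded prime submodules \<open>P\<close> whose colon
  ideal \<open>(P : M)\<close> avoids \<open>S\<close>.  Elements of \<open>S\<close> can be cancelled modulo such a \<open>P\<close>
  (\<open>graded_prime_submodule_cancel\<close>), so that \<open>m/s \<in> S\<inverse>P\<close> if and only if \<open>m \<in> P\<close>.  It follows
  that \<open>S\<inverse>P\<close> is graded prime and that its colon ideal consists of the \<open>r/s\<close> with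
  \<open>r \<in> (P : M)\<close>.  A graded prime \<open>q\<close> over \<open>(S\<inverse>N : S\<inverse>M)\<close> contracts to a graded prime \<open>p\<close>
  over \<open>(N : M)\<close> that avoids \<open>S\<close>; the graded prime submodule \<open>P\<close> that exists for \<open>p\<close> has a
  localization with colon ideal \<open>q\<close> (\<open>loc_primeful\<close>).  Properness needs one such \<open>p\<close>, which
  Zorn's lemma provides (\<open>exists_graded_prime_ideal_avoiding\<close>).

  That localization respects gradings is not immediate because \<open>G\<close> may be noncommutative.  The
  hypothesis on \<open>S\<close> implies \<open>0 \<notin> S\<close>, so products of elements of \<open>S\<close> are nonzero, and since
  \<open>R\<close> is commutative their degrees commute (\<open>S_degrees_commute\<close>).  Therefore finitely many
  homogeneous fractions have a common denominator without a change of degrees, which shows that the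
  components of \<open>S\<inverse>M\<close> are subgroups and independent (\<open>LM_independent\<close>).\<close>

section \<open>Independent families of subgroups and direct sums\<close>

text \<open>Closure under taking homogeneous components.  It speaks of finite sums instead of component
  maps, so that it makes sense before the family \<open>B\<close> is known to decompose the group; for
  \<open>X = {0}\<close> it says that \<open>B\<close> is linearly independent.  In contrast to the existence of a
  decomposition, it visibly passes to inverse images and to unions.\<close>

definition homogeneous_closed ::
    "('a, 'x) ring_scheme \<Rightarrow> 'i set \<Rightarrow> ('i \<Rightarrow> 'a set) \<Rightarrow> 'a set \<Rightarrow> bool"
  where "homogeneous_closed A I B X \<longleftrightarrow>
    (\<forall>F f. finite F \<and> F \<subseteq> I \<and> f \<in> Pi F B \<and> finsum A f F \<in> X \<longrightarrow> (\<forall>i\<in>F. f i \<in> X))"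

lemma homogeneous_closedD:
  assumes "homogeneous_closed A I B X" "finite F" "F \<subseteq> I" "f \<in> Pi F B" "finsum A f F \<in> X" "i \<in> F"
  shows "f i \<in> X"
  using assms unfolding homogeneous_closed_def by blast

text \<open>Record types differ between rings and modules, so that the same additive group occurs under two
  types; this moves a decomposition from one to the other.\<close>

lemma is_direct_sum_cong_structure:
  fixes I :: "'i set"
  assumes "carrier A = carrier A'" "add A = add A'" "zero A = zero A'"
  shows "is_direct_sum A I B C \<longleftrightarrow> is_direct_sum A' I B C"
proof -
  have "finsum A = (finsum A' :: ('i \<Rightarrow> _) \<Rightarrow> _)"
    using assms by (intro ext) (simp add: finsum_def finprod_def)
  with assms show ?thesis
    by (simp add: is_direct_sum_def additive_subgroup_def subgroup_def m_inv_def
        family_sum_def [abs_def] fin_supp_families_def)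
qed

lemma (in additive_subgroup) finsum_mem:
  assumes "abelian_group G" "f \<in> F \<rightarrow> H"
  shows "finsum G f F \<in> H"
proof -
  interpret abelian_group G by fact
  show ?thesis
    using assms(2)
  proof (induction F rule: infinite_finite_induct)
    case (insert x F)
    then have "f \<in> F \<rightarrow> carrier G" "f x \<in> carrier G"
      using a_subset by auto
    with insert show ?case
      by (simp add: finsum_insert)
  qed auto
qed

lemma hom_finsum_commute:
  assumes "abelian_group A" "abelian_group A'"
    and hom: "\<phi> \<in> hom (add_monoid A) (add_monoid A')"
    and "f \<in> F \<rightarrow> carrier A"
  shows "\<phi> (finsum A f F) = finsum A' (\<lambda>i. \<phi> (f i)) F"
proof -
  interpret A: abelian_group A by fact
  interpret A': abelian_group A' by fact
  interpret group_hom "add_monoid A" "add_monoid A'" \<phi>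
    by unfold_locales (rule hom)
  have c: "\<phi> x \<in> carrier A'" if "x \<in> carrier A" for x
    using hom_closed that by simp
  have z: "\<phi> \<zero>\<^bsub>A\<^esub> = \<zero>\<^bsub>A'\<^esub>"
    using hom_one by simp
  show ?thesis
    using assms(4)
  proof (induction F rule: infinite_finite_induct)
    case (insert x F)
    then have "f \<in> F \<rightarrow> carrier A" "f x \<in> carrier A" by auto
    with insert show ?case
      using hom_mult by (simp add: A.finsum_insert A'.finsum_insert Pi_def c)
  qed (simp_all add: z)
qed

context abelian_group
begin

lemma family_sum_eq_finsum:
  assumes "finite F" "F \<subseteq> I" "\<And>i. i \<in> F \<Longrightarrow> f i \<in> carrier G" "\<And>i. i \<in> I - F \<Longrightarrow> f i = \<zero>"
  shows "family_sum G I f = finsum G f F"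
  unfolding family_sum_def
  by (rule add.finprod_mono_neutral_cong_left) (use assms in auto)

lemma finsum_minus:
  assumes "f \<in> F \<rightarrow> carrier G" "g \<in> F \<rightarrow> carrier G"
  shows "finsum G (\<lambda>i. f i \<ominus> g i) F = finsum G f F \<ominus> finsum G g F"
proof -
  have zero: "\<ominus> \<zero> = \<zero>"
    by (rule minus_equality) simp_all
  show ?thesis
    using assms
  proof (induction F rule: infinite_finite_induct)
    case (insert x F)
    then have *: "f \<in> F \<rightarrow> carrier G" "g \<in> F \<rightarrow> carrier G" "f x \<in> carrier G" "g x \<in> carrier G"
      "(\<lambda>i. f i \<ominus> g i) \<in> F \<rightarrow> carrier G"
      by auto
    with insert show ?case
      by (simp add: finsum_insert minus_add a_minus_def a_ac)
  qed (simp_all add: a_minus_def zero)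
qed

text \<open>The difference of the two families is a relation between elements of the components, and
  independence kills each of its terms.\<close>

lemma finite_sums_eqI:
  assumes sub: "\<And>i. i \<in> I \<Longrightarrow> additive_subgroup (B i) G"
    and ind: "homogeneous_closed G I B {\<zero>}"
    and F: "finite F" "F \<subseteq> I" "f \<in> Pi F B" "g \<in> Pi F B" "finsum G f F = finsum G g F"
    and i: "i \<in> F"
  shows "f i = g i"
proof -
  have B: "B j \<subseteq> carrier G" if "j \<in> I" for j
    using additive_subgroup.a_subset[OF sub[OF that]] .
  have m: "f j \<ominus> g j \<in> B j" if "j \<in> F" for j
  proof -
    interpret additive_subgroup "B j" G using sub that F by auto
    have "f j \<in> B j" "g j \<in> B j" using that F by auto
    then show ?thesis
      by (simp add: a_minus_def)
  qed
  have f: "f \<in> F \<rightarrow> carrier G" "g \<in> F \<rightarrow> carrier G"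
    using F B by blast+
  have "finsum G (\<lambda>i. f i \<ominus> g i) F = \<zero>"
    using F f by (simp add: finsum_minus) (simp add: r_neg a_minus_def)
  then have "f i \<ominus> g i \<in> {\<zero>}"
    using homogeneous_closedD[OF ind F(1,2), of "\<lambda>i. f i \<ominus> g i" i] m i by auto
  then show ?thesis
    using f i minus_equality[of "f i" "\<ominus> g i"] by (auto simp: Pi_def a_minus_def)
qed

lemma family_sum_image:
  assumes sub: "\<And>i. i \<in> I \<Longrightarrow> additive_subgroup (B i) G"
  shows "family_sum G I ` fin_supp_families G I B = 
         {finsum G f F | f F. finite F \<and> F \<subseteq> I \<and> f \<in> Pi F B}" (is "?L = ?R")
proof (intro equalityI subsetI)
  have B: "B j \<subseteq> carrier G" if "j \<in> I" for j
    using additive_subgroup.a_subset[OF sub[OF that]] .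
  {
    fix x assume "x \<in> ?L"
    then obtain f where f: "f \<in> fin_supp_families G I B" "x = family_sum G I f" by auto
    then show "x \<in> ?R"
      unfolding fin_supp_families_def family_sum_def
      by (intro CollectI exI[of _ f] exI[of _ "{i \<in> I. f i \<noteq> \<zero>}"]) auto
  next
    fix x assume "x \<in> ?R"
    then obtain f F where f: "finite F" "F \<subseteq> I" "f \<in> Pi F B" "x = finsum G f F" by auto
    let ?h = "\<lambda>i\<in>I. if i \<in> F then f i else \<zero>"
    have "?h i \<in> B i" if "i \<in> I" for i
      using that f additive_subgroup.zero_closed[OF sub] by auto
    moreover have "finite {i \<in> I. ?h i \<noteq> \<zero>}"
      by (rule finite_subset[OF _ f(1)]) auto
    ultimately have "?h \<in> fin_supp_families G I B"
      unfolding fin_supp_families_def by auto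
    moreover have "family_sum G I ?h = finsum G ?h F"
      using f B by (intro family_sum_eq_finsum) (auto simp: Pi_iff subset_iff)
    moreover have "\<dots> = x"
      unfolding f(4) using f B by (intro finsum_cong') (auto simp: Pi_iff subset_iff)
    ultimately show "x \<in> ?L" by (intro image_eqI[of _ _ ?h]) simp_all
  }
qed

lemma is_direct_sum_imp_independent:
  assumes "is_direct_sum G I B C"
  shows "homogeneous_closed G I B {\<zero>}"
  unfolding homogeneous_closed_def
proof (intro allI impI ballI, elim conjE)
  fix F f i
  assume F: "finite F" "F \<subseteq> I" "f \<in> Pi F B" "finsum G f F \<in> {\<zero>}" and i: "i \<in> F"
  have sub: "\<And>i. i \<in> I \<Longrightarrow> additive_subgroup (B i) G"
    and inj: "inj_on (family_sum G I) (fin_supp_families G I B)"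
    using assms by (auto simp: is_direct_sum_def bij_betw_def)
  have B: "B j \<subseteq> carrier G" if "j \<in> I" for j
    using additive_subgroup.a_subset[OF sub[OF that]] .
  let ?h = "\<lambda>i\<in>I. if i \<in> F then f i else \<zero>" and ?z = "\<lambda>i\<in>I. \<zero>"
  have h: "?h i \<in> B i" "?z i \<in> B i" if "i \<in> I" for i
    using that F additive_subgroup.zero_closed[OF sub] by auto
  have "finite {i \<in> I. ?h i \<noteq> \<zero>}"
    by (rule finite_subset[OF _ F(1)]) auto
  with h have fam: "?h \<in> fin_supp_families G I B" "?z \<in> fin_supp_families G I B"
    unfolding fin_supp_families_def by auto
  have "family_sum G I ?h = finsum G ?h F" 
    using F B by (intro family_sum_eq_finsum) (auto simp: Pi_iff subset_iff)
  moreover have "finsum G ?h F = finsum G f F"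
    using F B by (intro finsum_cong') (auto simp: Pi_iff subset_iff)
  moreover have "family_sum G I ?z = finsum G ?z {}"
    using F B by (intro family_sum_eq_finsum) auto
  ultimately have "family_sum G I ?h = family_sum G I ?z"
    using F by simp
  with inj fam have "?h = ?z" by (auto dest: inj_onD)
  then have "?h i = ?z i" by metis
  with i F show "f i \<in> {\<zero>}" by auto
qed

lemma direct_sum_finite_sum:
  assumes "is_direct_sum G I B C" "x \<in> C"
  obtains F f where "finite F" "F \<subseteq> I" "f \<in> Pi F B" "x = finsum G f F"
proof -
  have "C = {finsum G f F | f F. finite F \<and> F \<subseteq> I \<and> f \<in> Pi F B}"
    using assms(1) family_sum_image[of I B] by (simp add: bij_betw_def is_direct_sum_def)
  with assms that show ?thesis by auto
qed

text \<open>Criterion for a direct sum without families of finite support: independence gives uniqueness of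
  the decomposition, and the finite sums form a subgroup, which gives existence.\<close>

lemma is_direct_sumI:
  assumes sub: "\<And>i. i \<in> I \<Longrightarrow> additive_subgroup (B i) G"
    and ind: "homogeneous_closed G I B {\<zero>}"
    and C: "C = generate (add_monoid G) (\<Union>i\<in>I. B i)"
  shows "is_direct_sum G I B C"
proof -
  have B: "B j \<subseteq> carrier G" if "j \<in> I" for j
    using additive_subgroup.a_subset[OF sub[OF that]] .
  have "inj_on (family_sum G I) (fin_supp_families G I B)"
  proof (rule inj_onI)
    fix f g assume f: "f \<in> fin_supp_families G I B" and g: "g \<in> fin_supp_families G I B"
      and eq: "family_sum G I f = family_sum G I g"
    define F where "F = {i \<in> I. f i \<noteq> \<zero>} \<union> {i \<in> I. g i \<noteq> \<zero>}"
    have F: "finite F" "F \<subseteq> I" "f \<in> Pi F B" "g \<in> Pi F B"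
      using f g by (auto simp: F_def fin_supp_families_def PiE_iff)
    have "f i \<in> carrier G" "g i \<in> carrier G" if "i \<in> I" for i
      using f g B that by (auto simp: fin_supp_families_def PiE_iff)
    then have "family_sum G I f = finsum G f F" "family_sum G I g = finsum G g F"
      by (intro family_sum_eq_finsum; use F in \<open>auto simp: F_def\<close>)+
    with eq have "finsum G f F = finsum G g F" by simp
    from finite_sums_eqI[OF sub ind F this] have "f i = g i" if "i \<in> F" for i
      using that by auto
    moreover have "f i = g i" if "i \<notin> F" for i
      using f g that by (cases "i \<in> I") (auto simp: F_def fin_supp_families_def PiE_iff extensional_def)
    ultimately show "f = g" by auto
  qed
  moreover have "{finsum G f F | f F. finite F \<and> F \<subseteq> I \<and> f \<in> Pi F B} = C" (is "?R = C")
  proof (intro equalityI subsetI)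
    fix x assume "x \<in> ?R"
    then obtain f F where f: "finite F" "F \<subseteq> I" "f \<in> Pi F B" "x = finsum G f F" by auto
    interpret C: additive_subgroup C G
      unfolding C using B by (intro additive_subgroup.intro add.generate_is_subgroup) auto
    show "x \<in> C"
      unfolding f(4) using f by (intro C.finsum_mem abelian_group_axioms) (auto simp: C intro!: generate.incl)
  next
    have fam: "?R = family_sum G I ` fin_supp_families G I B"
      by (rule family_sum_image[OF sub, symmetric])
    have single: "h \<in> ?R" if "i \<in> I" "h \<in> B i" for h i
    proof -
      have "finsum G (\<lambda>_. h) {i} = h"
        using that B by (subst finsum_insert) (auto simp: subset_iff)
      then show ?thesis
        using that by (intro CollectI exI[of _ "\<lambda>_. h"] exI[of _ "{i}"]) auto
    qed
    have plus: "x \<oplus> y \<in> ?R" if x: "x \<in> ?R" and y: "y \<in> ?R" for x y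
    proof -
      obtain f where f: "f \<in> fin_supp_families G I B" "x = family_sum G I f"
        using x fam by auto
      obtain g where g: "g \<in> fin_supp_families G I B" "y = family_sum G I g"
        using y fam by auto
      define F where "F = {i \<in> I. f i \<noteq> \<zero>} \<union> {i \<in> I. g i \<noteq> \<zero>}"
      have F: "finite F" "F \<subseteq> I" "f \<in> Pi F B" "g \<in> Pi F B"
        using f g by (auto simp: F_def fin_supp_families_def PiE_iff)
      have "f i \<in> carrier G" "g i \<in> carrier G" if "i \<in> I" for i
        using f g B that by (auto simp: fin_supp_families_def PiE_iff)
      then have "x = finsum G f F" "y = finsum G g F"
        unfolding f(2) g(2) by (intro family_sum_eq_finsum; use F in \<open>auto simp: F_def\<close>)+
      then have "x \<oplus> y = finsum G (\<lambda>i. f i \<oplus> g i) F"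
        using F B by (subst finsum_addf) blast+
      moreover have "f i \<oplus> g i \<in> B i" if "i \<in> F" for i
        using additive_subgroup.a_closed[OF sub] F that by blast
      ultimately show ?thesis
        using F by (intro CollectI exI[of _ "\<lambda>i. f i \<oplus> g i"] exI[of _ F]) auto
    qed
    fix x assume "x \<in> C"
    then show "x \<in> ?R"
      unfolding C
    proof (induction rule: generate.induct)
      case one
      then show ?case
        by (simp, intro exI[of _ "\<lambda>_. \<zero>"] exI[of _ "{}"]) auto
    next
      case (incl h)
      then show ?case using single by blast
    next
      case (inv h)
      then obtain i where i: "i \<in> I" "h \<in> B i" by auto
      then have "\<ominus> h \<in> B i"
        using additive_subgroup.a_inv_closed[OF sub] abelian_group_axioms by blast
      from single[OF i(1) this] show ?case by (simp add: a_inv_def)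
    next
      case (eng h1 h2)
      then show ?case using plus by simp
    qed
  qed
  ultimately show ?thesis
    using sub family_sum_image[of I B] unfolding is_direct_sum_def bij_betw_def by auto
qed

text \<open>Otherwise \<open>x + (-x) = 0\<close> would be a nontrivial relation between two components.\<close>

lemma degree_unique:
  assumes sub: "\<And>i. i \<in> I \<Longrightarrow> additive_subgroup (B i) G"
    and ind: "homogeneous_closed G I B {\<zero>}"
    and x: "i \<in> I" "j \<in> I" "x \<in> B i" "x \<in> B j" "x \<noteq> \<zero>"
  shows "i = j"
proof (rule ccontr)
  assume ne: "i \<noteq> j"
  have c: "x \<in> carrier G" "\<ominus> x \<in> B j"
    using x additive_subgroup.a_subset[OF sub] additive_subgroup.a_inv_closed[OF sub] 
      abelian_group_axioms by blast+
  let ?f = "\<lambda>k. if k = i then x else \<ominus> x"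
  have "finsum G ?f {i, j} = \<zero>"
    using ne c by (simp add: finsum_insert r_neg)
  moreover have "?f \<in> Pi {i, j} B"
    using x c by auto
  ultimately have "?f i \<in> {\<zero>}"
    using homogeneous_closedD[OF ind, of "{i, j}" ?f i] x by blast
  with x show False by simp
qed

lemma is_direct_sum_subgroupI:
  assumes sub: "\<And>i. i \<in> I \<Longrightarrow> additive_subgroup (B i) G"
    and ind: "homogeneous_closed G I B {\<zero>}"
    and X: "additive_subgroup X G"
    and gen: "X \<subseteq> generate (add_monoid G) (\<Union>i\<in>I. X \<inter> B i)"
  shows "is_direct_sum G I (\<lambda>i. X \<inter> B i) X"
proof (rule is_direct_sumI)
  show "additive_subgroup (X \<inter> B i) G" if "i \<in> I" for i
    using add.subgroups_Inter_pair[of X "B i"] X sub that 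
    by (simp add: additive_subgroup_def)
  show "homogeneous_closed G I (\<lambda>i. X \<inter> B i) {\<zero>}"
    using ind by (auto simp: homogeneous_closed_def Pi_def)
  show "X = generate (add_monoid G) (\<Union>i\<in>I. X \<inter> B i)"
    using gen add.generate_subgroup_incl[of "\<Union>i\<in>I. X \<inter> B i" X] X by (auto simp: additive_subgroup_def)
qed

text \<open>A finite sum of homogeneous elements that lies in \<open>X\<close> has a second decomposition, with
  components in \<open>X\<close>, and independence in the ambient group identifies the two.\<close>

lemma is_direct_sum_imp_homogeneous_closed:
  assumes sub: "\<And>i. i \<in> I \<Longrightarrow> additive_subgroup (B i) G"
    and ind: "homogeneous_closed G I B {\<zero>}"
    and X: "is_direct_sum G I (\<lambda>i. X \<inter> B i) X"
  shows "homogeneous_closed G I B X"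
  unfolding homogeneous_closed_def
proof (intro allI impI ballI, elim conjE)
  fix F f i
  assume F: "finite F" "F \<subseteq> I" "f \<in> Pi F B" "finsum G f F \<in> X" and i: "i \<in> F"
  have B: "B j \<subseteq> carrier G" if "j \<in> I" for j
    using additive_subgroup.a_subset[OF sub[OF that]] .
  obtain K h where K: "finite K" "K \<subseteq> I" "h \<in> Pi K (\<lambda>i. X \<inter> B i)" "finsum G f F = finsum G h K"
    using direct_sum_finite_sum[OF X F(4)] by metis
  have zero: "\<zero> \<in> X \<inter> B j" if "j \<in> I" for j
    using X that additive_subgroup.zero_closed unfolding is_direct_sum_def by fast
  \<comment> \<open>extend both families by zero to the union of their index sets\<close>
  let ?f = "\<lambda>j. if j \<in> F then f j else \<zero>" and ?h = "\<lambda>j. if j \<in> K then h j else \<zero>"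
  have "finsum G f F = finsum G ?f (F \<union> K)"
    by (rule add.finprod_mono_neutral_cong_left) (use F K B in \<open>auto, blast+\<close>)
  moreover have "finsum G h K = finsum G ?h (F \<union> K)"
    by (rule add.finprod_mono_neutral_cong_left) (use F K B in \<open>auto, blast+\<close>)
  ultimately have eq: "finsum G ?f (F \<union> K) = finsum G ?h (F \<union> K)"
    using K by simp
  have "?f \<in> Pi (F \<union> K) B" "?h \<in> Pi (F \<union> K) B"
    using F K zero by (auto simp: Pi_iff)
  then have "?f i = ?h i"
    using finite_sums_eqI[OF sub ind _ _ _ _ eq, of i] F K i by blast
  moreover have "?h i \<in> X" using K zero F i by auto
  ultimately show "f i \<in> X" using i by simp
qed

lemma homogeneous_closed_imp_is_direct_sum:
  assumes dir: "is_direct_sum G I B (carrier G)"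
    and X: "additive_subgroup X G" and closed: "homogeneous_closed G I B X"
  shows "is_direct_sum G I (\<lambda>i. X \<inter> B i) X"
proof (rule is_direct_sum_subgroupI)
  show sub: "\<And>i. i \<in> I \<Longrightarrow> additive_subgroup (B i) G"
    using dir by (auto simp: is_direct_sum_def)
  show "homogeneous_closed G I B {\<zero>}"
    using is_direct_sum_imp_independent[OF dir] .
  show "additive_subgroup X G" by fact
  show "X \<subseteq> generate (add_monoid G) (\<Union>i\<in>I. X \<inter> B i)" (is "_ \<subseteq> ?H")
  proof
    fix x assume x: "x \<in> X"
    then have "x \<in> carrier G" using additive_subgroup.a_subset[OF X] by auto
    then obtain F f where F: "finite F" "F \<subseteq> I" "f \<in> Pi F B" "x = finsum G f F"
      by (rule direct_sum_finite_sum[OF dir])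
    interpret H: additive_subgroup ?H G
      using additive_subgroup.a_subset[OF X]
      by (intro additive_subgroup.intro add.generate_is_subgroup) auto
    have "f i \<in> ?H" if "i \<in> F" for i
      using homogeneous_closedD[OF closed F(1-3) _ that] F x that by (auto intro!: generate.incl)
    then show "x \<in> ?H"
      unfolding F(4) by (intro H.finsum_mem abelian_group_axioms) auto
  qed
qed

end

text \<open>Homomorphisms may shift degrees here, as long as different degrees stay different: this covers
  multiplication by a homogeneous element as well as passage to fractions.\<close>

lemma homogeneous_closed_vimage:
  assumes A: "abelian_group A" and A': "abelian_group A'"
    and \<phi>: "\<phi> \<in> hom (add_monoid A) (add_monoid A')"
    and B: "\<And>i. i \<in> I \<Longrightarrow> B i \<subseteq> carrier A"
    and \<sigma>: "inj_on \<sigma> I" "\<sigma> ` I \<subseteq> I'"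
    and deg: "\<And>i x. \<lbrakk>i \<in> I; x \<in> B i\<rbrakk> \<Longrightarrow> \<phi> x \<in> B' (\<sigma> i)"
    and closed: "homogeneous_closed A' I' B' X"
  shows "homogeneous_closed A I B {x \<in> carrier A. \<phi> x \<in> X}"
  unfolding homogeneous_closed_def
proof (intro allI impI ballI, elim conjE)
  fix F f i
  assume F: "finite F" "F \<subseteq> I" "f \<in> Pi F B" "finsum A f F \<in> {x \<in> carrier A. \<phi> x \<in> X}" and i: "i \<in> F"
  interpret A: abelian_group A by fact
  interpret A': abelian_group A' by fact
  have f: "f \<in> F \<rightarrow> carrier A" using F B by blast
  then have \<phi>f: "\<phi> (f j) \<in> carrier A'" if "j \<in> F" for j
    using \<phi> that by (auto simp: hom_def Pi_def)
  have inj: "inj_on \<sigma> F" using \<sigma> F inj_on_subset by blast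
  define h where "h = (\<lambda>k. \<phi> (f (inv_into F \<sigma> k)))"
  have h: "h (\<sigma> j) = \<phi> (f j)" if "j \<in> F" for j
    using that inj by (simp add: h_def)
  have "\<phi> (finsum A f F) = finsum A' (\<lambda>j. \<phi> (f j)) F"
    using hom_finsum_commute[OF A A' \<phi> f] .
  also have "\<dots> = finsum A' (\<lambda>j. h (\<sigma> j)) F"
    using h \<phi>f by (intro A'.finsum_cong') auto
  also have "\<dots> = finsum A' h (\<sigma> ` F)"
    using inj \<phi>f h by (intro A'.finsum_reindex[symmetric]) auto
  finally have "finsum A' h (\<sigma> ` F) \<in> X" using F by simp
  moreover have "h \<in> Pi (\<sigma> ` F) B'"
    using h deg F by (auto simp: Pi_def)
  ultimately have "h (\<sigma> i) \<in> X"
    using homogeneous_closedD[OF closed, of "\<sigma> ` F" h "\<sigma> i"] F \<sigma> i by blast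
  then show "f i \<in> {x \<in> carrier A. \<phi> x \<in> X}"
    using h i f by auto
qed

section \<open>Localization of modules\<close>

text \<open>A ring as a module over itself.  Ideals are then submodules and \<open>S\<inverse>R\<close> is the localized
  module, so that every fact about \<open>S\<inverse>M\<close> applies to \<open>S\<inverse>R\<close>.\<close>

definition ring_as_module :: "('r, 'y) ring_scheme \<Rightarrow> ('r, 'r) module"
  where "ring_as_module R = \<lparr>carrier = carrier R, monoid.mult = monoid.mult R, one = one R, zero = zero R,
    add = add R, smult = monoid.mult R\<rparr>"

lemma ring_as_module_simps [simp]:
  "carrier (ring_as_module R) = carrier R" "add (ring_as_module R) = add R"
  "zero (ring_as_module R) = zero R" "smult (ring_as_module R) = monoid.mult R"
  by (simp_all add: ring_as_module_def)

lemma (in cring) module_ring_as_module: "module R (ring_as_module R)"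
proof (rule moduleI)
  show "abelian_group (ring_as_module R)"
    by (rule abelian_groupI) (auto simp: a_ac intro: l_neg)
qed (auto simp: cring_axioms l_distr r_distr m_assoc)

lemma module_frac_ring_as_module: "module_frac S (ring_as_module R) = ring_frac R S"
  by (intro ext) (simp add: module_frac_def ring_frac_def module_frac_rel_def ring_frac_rel_def)

lemma loc_module_ring_as_module:
  "carrier (loc_module R S (ring_as_module R)) = carrier (loc_ring R S)"
  "add (loc_module R S (ring_as_module R)) = add (loc_ring R S)"
  "zero (loc_module R S (ring_as_module R)) = zero (loc_ring R S)"
  "smult (loc_module R S (ring_as_module R)) = monoid.mult (loc_ring R S)"
  by (simp_all add: loc_module_def loc_ring_def module_frac_ring_as_module
      module_frac_rel_def ring_frac_rel_def)

lemma Union_constant: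
  assumes "x \<in> U" "\<And>y. y \<in> U \<Longrightarrow> g y = c"
  shows "\<Union> (g ` U) = c"
  using assms by auto

locale module_localization = module R M
  for R :: "('r, 'y) ring_scheme" and M :: "('r, 'm, 'z) module_scheme" +
  fixes S :: "'r set"
  assumes S_submonoid: "submonoid S R"
begin

abbreviation frac :: "'m \<Rightarrow> 'r \<Rightarrow> ('m \<times> 'r) set" where "frac \<equiv> module_frac S M"
abbreviation rfrac :: "'r \<Rightarrow> 'r \<Rightarrow> ('r \<times> 'r) set" where "rfrac \<equiv> ring_frac R S"
abbreviation LM :: "(('r \<times> 'r) set, ('m \<times> 'r) set) module" where "LM \<equiv> loc_module R S M"
abbreviation LR :: "('r \<times> 'r) set ring" where "LR \<equiv> loc_ring R S"

lemma S_carrier: "s \<in> S \<Longrightarrow> s \<in> carrier R"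
  using submonoid.subset[OF S_submonoid] by auto

lemma S_mult [simp]: "s \<in> S \<Longrightarrow> t \<in> S \<Longrightarrow> s \<otimes>\<^bsub>R\<^esub> t \<in> S"
  using submonoid.m_closed[OF S_submonoid] .

lemma S_one [simp]: "\<one>\<^bsub>R\<^esub> \<in> S"
  using submonoid.one_closed[OF S_submonoid] .

lemma smult_left_commute:
  assumes "a \<in> carrier R" "b \<in> carrier R" "x \<in> carrier M"
  shows "a \<odot>\<^bsub>M\<^esub> (b \<odot>\<^bsub>M\<^esub> x) = b \<odot>\<^bsub>M\<^esub> (a \<odot>\<^bsub>M\<^esub> x)"
  using assms by (metis R.m_comm smult_assoc1)

lemma equiv_frac_rel: "equiv (carrier M \<times> S) (module_frac_rel S M)"
proof (rule equivI)
  show "module_frac_rel S M \<subseteq> (carrier M \<times> S) \<times> (carrier M \<times> S)"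
    by (auto simp: module_frac_rel_def)
  show "refl_on (carrier M \<times> S) (module_frac_rel S M)"
    using S_one by (auto simp: refl_on_def module_frac_rel_def)
  show "sym (module_frac_rel S M)"
    by (rule symI) (auto simp: module_frac_rel_def; metis)
  show "trans (module_frac_rel S M)"
  proof (rule transI)
    fix x y z assume "(x, y) \<in> module_frac_rel S M" "(y, z) \<in> module_frac_rel S M"
    then obtain m s n t k w u v where
      *: "x = (m, s)" "y = (n, t)" "z = (k, w)" 
      "m \<in> carrier M" "n \<in> carrier M" "k \<in> carrier M"
      "s \<in> S" "t \<in> S" "w \<in> S" "u \<in> S" "v \<in> S"
      "u \<odot>\<^bsub>M\<^esub> (t \<odot>\<^bsub>M\<^esub> m) = u \<odot>\<^bsub>M\<^esub> (s \<odot>\<^bsub>M\<^esub> n)" "v \<odot>\<^bsub>M\<^esub> (w \<odot>\<^bsub>M\<^esub> n) = v \<odot>\<^bsub>M\<^esub> (t \<odot>\<^bsub>M\<^esub> k)"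
      by (auto simp: module_frac_rel_def)
    note c = S_carrier[OF *(7)] S_carrier[OF *(8)] S_carrier[OF *(9)] S_carrier[OF *(10)]
      S_carrier[OF *(11)]
    \<comment> \<open>the middle denominator \<open>t\<close> is absorbed into the witness\<close>
    let ?u = "(u \<otimes>\<^bsub>R\<^esub> v) \<otimes>\<^bsub>R\<^esub> t"
    have "?u \<odot>\<^bsub>M\<^esub> (w \<odot>\<^bsub>M\<^esub> m) = v \<odot>\<^bsub>M\<^esub> (w \<odot>\<^bsub>M\<^esub> (u \<odot>\<^bsub>M\<^esub> (t \<odot>\<^bsub>M\<^esub> m)))"
      using c *(4-6) by (simp add: smult_assoc1 smult_left_commute)
    also have "\<dots> = u \<odot>\<^bsub>M\<^esub> (s \<odot>\<^bsub>M\<^esub> (v \<odot>\<^bsub>M\<^esub> (w \<odot>\<^bsub>M\<^esub> n)))"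
      unfolding *(12) using c *(4-6) by (simp add: smult_left_commute)
    also have "\<dots> = ?u \<odot>\<^bsub>M\<^esub> (s \<odot>\<^bsub>M\<^esub> k)"
      unfolding *(13) using c *(4-6) by (simp add: smult_assoc1 smult_left_commute)
    finally show "(x, z) \<in> module_frac_rel S M"
      using * by (auto simp: module_frac_rel_def intro!: bexI[of _ ?u])
  qed
qed

lemma frac_eq_iff:
  assumes "m \<in> carrier M" "n \<in> carrier M" "s \<in> S" "t \<in> S"
  shows "frac m s = frac n t \<longleftrightarrow> (\<exists>u\<in>S. u \<odot>\<^bsub>M\<^esub> (t \<odot>\<^bsub>M\<^esub> m) = u \<odot>\<^bsub>M\<^esub> (s \<odot>\<^bsub>M\<^esub> n))"
proof -
  have "frac m s = frac n t \<longleftrightarrow> ((m, s), (n, t)) \<in> module_frac_rel S M"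
    unfolding module_frac_def using assms by (intro eq_equiv_class_iff[OF equiv_frac_rel]) auto
  with assms show ?thesis by (simp add: module_frac_rel_def)
qed

lemma frac_eqI:
  assumes "m \<in> carrier M" "n \<in> carrier M" "s \<in> S" "t \<in> S" "t \<odot>\<^bsub>M\<^esub> m = s \<odot>\<^bsub>M\<^esub> n"
  shows "frac m s = frac n t"
  using assms by (subst frac_eq_iff) (auto intro!: bexI[of _ "\<one>\<^bsub>R\<^esub>"])

lemma frac_cancel:
  assumes "m \<in> carrier M" "s \<in> S" "t \<in> S"
  shows "frac (t \<odot>\<^bsub>M\<^esub> m) (t \<otimes>\<^bsub>R\<^esub> s) = frac m s"
  using assms S_carrier by (intro frac_eqI) (auto simp: smult_assoc1 smult_left_commute)

lemma carrier_LM_iff: "x \<in> carrier LM \<longleftrightarrow> (\<exists>m\<in>carrier M. \<exists>s\<in>S. x = frac m s)"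
  by (auto simp: loc_module_def quotient_def module_frac_def)

lemma frac_closed [simp]: "m \<in> carrier M \<Longrightarrow> s \<in> S \<Longrightarrow> frac m s \<in> carrier LM"
  by (auto simp: carrier_LM_iff)

lemma mem_fracD:
  assumes "(m', s') \<in> frac m s"
  shows "m' \<in> carrier M" "s' \<in> S" "m \<in> carrier M" "s \<in> S" 
    "\<exists>u\<in>S. u \<odot>\<^bsub>M\<^esub> (s' \<odot>\<^bsub>M\<^esub> m) = u \<odot>\<^bsub>M\<^esub> (s \<odot>\<^bsub>M\<^esub> m')"
  using assms by (auto simp: module_frac_def module_frac_rel_def)

lemma mem_frac: "m \<in> carrier M \<Longrightarrow> s \<in> S \<Longrightarrow> (m, s) \<in> frac m s"
  by (auto simp: module_frac_def module_frac_rel_def)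

text \<open>The sum is defined as a union over representatives; all of its members agree.\<close>

lemma add_frac:
  assumes "m \<in> carrier M" "n \<in> carrier M" "s \<in> S" "t \<in> S"
  shows "frac m s \<oplus>\<^bsub>LM\<^esub> frac n t = frac (t \<odot>\<^bsub>M\<^esub> m \<oplus>\<^bsub>M\<^esub> s \<odot>\<^bsub>M\<^esub> n) (s \<otimes>\<^bsub>R\<^esub> t)" (is "_ = ?c")
proof -
  have *: "frac (t' \<odot>\<^bsub>M\<^esub> m' \<oplus>\<^bsub>M\<^esub> s' \<odot>\<^bsub>M\<^esub> n') (s' \<otimes>\<^bsub>R\<^esub> t') = ?c"
    if fr: "(m', s') \<in> frac m s" "(n', t') \<in> frac n t" for m' s' n' t'
  proof -
    from fr(1) obtain u where u: "m' \<in> carrier M" "s' \<in> S" "u \<in> S" 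
      "u \<odot>\<^bsub>M\<^esub> (s' \<odot>\<^bsub>M\<^esub> m) = u \<odot>\<^bsub>M\<^esub> (s \<odot>\<^bsub>M\<^esub> m')"
      using mem_fracD[OF fr(1)] by blast
    from fr(2) obtain v where v: "n' \<in> carrier M" "t' \<in> S" "v \<in> S" 
      "v \<odot>\<^bsub>M\<^esub> (t' \<odot>\<^bsub>M\<^esub> n) = v \<odot>\<^bsub>M\<^esub> (t \<odot>\<^bsub>M\<^esub> n')"
      using mem_fracD[OF fr(2)] by blast
    note c = assms(1,2) S_carrier[OF assms(3)] S_carrier[OF assms(4)] S_carrier[OF u(2)] 
      S_carrier[OF u(3)] S_carrier[OF v(2)] S_carrier[OF v(3)] u(1) v(1)
    let ?w = "u \<otimes>\<^bsub>R\<^esub> v"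
    have "?w \<odot>\<^bsub>M\<^esub> ((s \<otimes>\<^bsub>R\<^esub> t) \<odot>\<^bsub>M\<^esub> (t' \<odot>\<^bsub>M\<^esub> m' \<oplus>\<^bsub>M\<^esub> s' \<odot>\<^bsub>M\<^esub> n')) =
      v \<odot>\<^bsub>M\<^esub> (t \<odot>\<^bsub>M\<^esub> (t' \<odot>\<^bsub>M\<^esub> (u \<odot>\<^bsub>M\<^esub> (s \<odot>\<^bsub>M\<^esub> m')))) \<oplus>\<^bsub>M\<^esub> u \<odot>\<^bsub>M\<^esub> (s \<odot>\<^bsub>M\<^esub> (s' \<odot>\<^bsub>M\<^esub> (v \<odot>\<^bsub>M\<^esub> (t \<odot>\<^bsub>M\<^esub> n'))))"
      using c by (simp add: smult_assoc1 smult_r_distr smult_left_commute)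
    also have "\<dots> = ?w \<odot>\<^bsub>M\<^esub> ((s' \<otimes>\<^bsub>R\<^esub> t') \<odot>\<^bsub>M\<^esub> (t \<odot>\<^bsub>M\<^esub> m \<oplus>\<^bsub>M\<^esub> s \<odot>\<^bsub>M\<^esub> n))"
      unfolding u(4)[symmetric] v(4)[symmetric]
      using c by (simp add: smult_assoc1 smult_r_distr smult_left_commute)
    finally show ?thesis
      using c u v assms by (subst frac_eq_iff) auto
  qed
  show ?thesis
    unfolding loc_module_def
    by (simp, rule Union_constant, rule mem_frac[OF assms(1,3)], clarify, rule Union_constant,
        rule mem_frac[OF assms(2,4)], clarify, rule *)
qed

lemma add_frac_same:
  assumes "m \<in> carrier M" "n \<in> carrier M" "s \<in> S"
  shows "frac m s \<oplus>\<^bsub>LM\<^esub> frac n s = frac (m \<oplus>\<^bsub>M\<^esub> n) s"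
  using assms S_carrier frac_cancel[of "m \<oplus>\<^bsub>M\<^esub> n" s s] by (simp add: add_frac smult_r_distr)

lemma zero_LM: "s \<in> S \<Longrightarrow> \<zero>\<^bsub>LM\<^esub> = frac \<zero>\<^bsub>M\<^esub> s"
  using S_carrier frac_eqI[of "\<zero>\<^bsub>M\<^esub>" "\<zero>\<^bsub>M\<^esub>" "\<one>\<^bsub>R\<^esub>" s] by (simp add: loc_module_def)

lemma frac_eq_zero_iff:
  assumes "m \<in> carrier M" "s \<in> S"
  shows "frac m s = \<zero>\<^bsub>LM\<^esub> \<longleftrightarrow> (\<exists>u\<in>S. u \<odot>\<^bsub>M\<^esub> m = \<zero>\<^bsub>M\<^esub>)"
  using assms S_carrier by (simp add: zero_LM[OF S_one] frac_eq_iff)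

text \<open>Over a common denominator, addition of fractions is addition of numerators, which reduces the
  group axioms of \<open>S\<inverse>M\<close> to those of \<open>M\<close>.\<close>

lemma common_denominator2:
  assumes "x \<in> carrier LM" "y \<in> carrier LM"
  obtains m n s where "m \<in> carrier M" "n \<in> carrier M" "s \<in> S" "x = frac m s" "y = frac n s"
proof -
  from assms obtain m s n t where *: "m \<in> carrier M" "s \<in> S" "x = frac m s"
    "n \<in> carrier M" "t \<in> S" "y = frac n t"
    by (auto simp: carrier_LM_iff)
  show thesis
    using * S_carrier
    by (intro that[of "t \<odot>\<^bsub>M\<^esub> m" "s \<odot>\<^bsub>M\<^esub> n" "t \<otimes>\<^bsub>R\<^esub> s"])
      (simp_all add: frac_cancel, metis R.m_comm frac_cancel)
qed

sublocale LM: abelian_group LM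
proof (rule abelian_groupI)
  fix x y assume x: "x \<in> carrier LM" and y: "y \<in> carrier LM"
  then obtain m n s where *: "m \<in> carrier M" "n \<in> carrier M" "s \<in> S" "x = frac m s" "y = frac n s"
    by (rule common_denominator2)
  then show "x \<oplus>\<^bsub>LM\<^esub> y \<in> carrier LM" "x \<oplus>\<^bsub>LM\<^esub> y = y \<oplus>\<^bsub>LM\<^esub> x"
    by (simp_all add: add_frac_same M.a_comm)
  fix z assume "z \<in> carrier LM"
  then obtain k t where k: "k \<in> carrier M" "t \<in> S" "z = frac k t"
    by (auto simp: carrier_LM_iff)
  have "x = frac (t \<odot>\<^bsub>M\<^esub> m) (t \<otimes>\<^bsub>R\<^esub> s)" "y = frac (t \<odot>\<^bsub>M\<^esub> n) (t \<otimes>\<^bsub>R\<^esub> s)"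
    "z = frac (s \<odot>\<^bsub>M\<^esub> k) (t \<otimes>\<^bsub>R\<^esub> s)"
    using * k frac_cancel S_carrier by (simp_all, metis R.m_comm)
  then show "x \<oplus>\<^bsub>LM\<^esub> y \<oplus>\<^bsub>LM\<^esub> z = x \<oplus>\<^bsub>LM\<^esub> (y \<oplus>\<^bsub>LM\<^esub> z)"
    using * k S_carrier by (simp add: add_frac_same M.a_assoc)
next
  show "\<zero>\<^bsub>LM\<^esub> \<in> carrier LM"
    by (simp add: zero_LM[OF S_one])
  fix x assume "x \<in> carrier LM"
  then obtain m s where *: "m \<in> carrier M" "s \<in> S" "x = frac m s"
    by (auto simp: carrier_LM_iff)
  then show "\<zero>\<^bsub>LM\<^esub> \<oplus>\<^bsub>LM\<^esub> x = x"
    by (simp add: zero_LM[of s] add_frac_same)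
  show "\<exists>y\<in>carrier LM. y \<oplus>\<^bsub>LM\<^esub> x = \<zero>\<^bsub>LM\<^esub>"
    using * by (intro bexI[of _ "frac (\<ominus>\<^bsub>M\<^esub> m) s"]) (simp_all add: zero_LM[of s] add_frac_same M.l_neg)
qed

lemma a_inv_frac:
  assumes "m \<in> carrier M" "s \<in> S"
  shows "\<ominus>\<^bsub>LM\<^esub> frac m s = frac (\<ominus>\<^bsub>M\<^esub> m) s"
  using assms by (intro LM.minus_equality) (simp_all add: add_frac_same zero_LM[of s] M.l_neg)

lemma finsum_frac:
  assumes "s \<in> S" "f \<in> F \<rightarrow> carrier M"
  shows "finsum LM (\<lambda>i. frac (f i) s) F = frac (finsum M f F) s"
  using assms(2)
proof (induction F rule: infinite_finite_induct)
  case (insert x F)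
  then have "f \<in> F \<rightarrow> carrier M" "f x \<in> carrier M" by auto
  with insert show ?case
    using assms(1) by (simp add: LM.finsum_insert M.finsum_insert Pi_def add_frac_same)
qed (simp_all add: zero_LM[OF assms(1)])

lemma carrier_LR_iff: "x \<in> carrier LR \<longleftrightarrow> (\<exists>r\<in>carrier R. \<exists>s\<in>S. x = rfrac r s)"
  by (auto simp: loc_ring_def quotient_def ring_frac_def)

lemma rfrac_closed [simp]: "r \<in> carrier R \<Longrightarrow> s \<in> S \<Longrightarrow> rfrac r s \<in> carrier LR"
  by (auto simp: carrier_LR_iff)

lemma smult_frac:
  assumes "a \<in> carrier R" "m \<in> carrier M" "s \<in> S" "t \<in> S"
  shows "rfrac a s \<odot>\<^bsub>LM\<^esub> frac m t = frac (a \<odot>\<^bsub>M\<^esub> m) (s \<otimes>\<^bsub>R\<^esub> t)" (is "_ = ?c")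
proof -
  have *: "frac (a' \<odot>\<^bsub>M\<^esub> m') (s' \<otimes>\<^bsub>R\<^esub> t') = ?c"
    if fr: "(a', s') \<in> rfrac a s" "(m', t') \<in> frac m t" for a' s' m' t'
  proof -
    from fr(1) obtain u where u: "a' \<in> carrier R" "s' \<in> S" "u \<in> S" 
      "u \<otimes>\<^bsub>R\<^esub> (s' \<otimes>\<^bsub>R\<^esub> a) = u \<otimes>\<^bsub>R\<^esub> (s \<otimes>\<^bsub>R\<^esub> a')"
      by (auto simp: ring_frac_def ring_frac_rel_def)
    from fr(2) obtain v where v: "m' \<in> carrier M" "t' \<in> S" "v \<in> S" 
      "v \<odot>\<^bsub>M\<^esub> (t' \<odot>\<^bsub>M\<^esub> m) = v \<odot>\<^bsub>M\<^esub> (t \<odot>\<^bsub>M\<^esub> m')"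
      using mem_fracD[OF fr(2)] by blast
    note c = assms(1,2) S_carrier[OF assms(3)] S_carrier[OF assms(4)] S_carrier[OF u(2)] 
      S_carrier[OF u(3)] S_carrier[OF v(2)] S_carrier[OF v(3)] u(1) v(1)
    let ?w = "u \<otimes>\<^bsub>R\<^esub> v"
    have "?w \<odot>\<^bsub>M\<^esub> ((s \<otimes>\<^bsub>R\<^esub> t) \<odot>\<^bsub>M\<^esub> (a' \<odot>\<^bsub>M\<^esub> m')) =
      (u \<otimes>\<^bsub>R\<^esub> (s \<otimes>\<^bsub>R\<^esub> a')) \<odot>\<^bsub>M\<^esub> (v \<odot>\<^bsub>M\<^esub> (t \<odot>\<^bsub>M\<^esub> m'))"
      using c by (simp add: smult_assoc1 smult_left_commute)
    also have "\<dots> = ?w \<odot>\<^bsub>M\<^esub> ((s' \<otimes>\<^bsub>R\<^esub> t') \<odot>\<^bsub>M\<^esub> (a \<odot>\<^bsub>M\<^esub> m))"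
      unfolding u(4)[symmetric] v(4)[symmetric]
      using c by (simp add: smult_assoc1 smult_left_commute)
    finally show ?thesis
      using c u v assms by (subst frac_eq_iff) auto
  qed
  have mem: "(a, s) \<in> rfrac a s"
    using assms by (auto simp: ring_frac_def ring_frac_rel_def)
  show ?thesis
    unfolding loc_module_def
    by (simp, rule Union_constant, rule mem, clarify, rule Union_constant,
        rule mem_frac[OF assms(2,4)], clarify, rule *)
qed

lemma frac_as_smult:
  assumes "m \<in> carrier M" "s \<in> S"
  shows "frac m s = rfrac \<one>\<^bsub>R\<^esub> s \<odot>\<^bsub>LM\<^esub> frac m \<one>\<^bsub>R\<^esub>"
  using assms S_carrier by (simp add: smult_frac)

lemma frac_one_hom: "(\<lambda>m. frac m \<one>\<^bsub>R\<^esub>) \<in> hom (add_monoid M) (add_monoid LM)"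
  by (auto simp: hom_def add_frac_same)

lemma loc_submoduleI: "n \<in> N \<Longrightarrow> s \<in> S \<Longrightarrow> frac n s \<in> loc_submodule S M N"
  by (auto simp: loc_submodule_def)

text \<open>A fraction with numerator outside \<open>N\<close> may still lie in \<open>S\<inverse>N\<close>; clearing denominators
  leaves exactly this freedom of a factor from \<open>S\<close>.\<close>

lemma loc_submodule_iff:
  assumes N: "submodule N R M" and x: "m \<in> carrier M" "s \<in> S"
  shows "frac m s \<in> loc_submodule S M N \<longleftrightarrow> (\<exists>u\<in>S. u \<odot>\<^bsub>M\<^esub> m \<in> N)"
proof
  assume "frac m s \<in> loc_submodule S M N"
  then obtain n t where n: "n \<in> N" "t \<in> S" "frac m s = frac n t"
    by (auto simp: loc_submodule_def)
  then have "n \<in> carrier M" using submoduleE(1)[OF N] by auto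
  with n x obtain u where u: "u \<in> S" "u \<odot>\<^bsub>M\<^esub> (t \<odot>\<^bsub>M\<^esub> m) = u \<odot>\<^bsub>M\<^esub> (s \<odot>\<^bsub>M\<^esub> n)"
    by (auto simp: frac_eq_iff)
  have "u \<odot>\<^bsub>M\<^esub> (s \<odot>\<^bsub>M\<^esub> n) \<in> N"
    using u n x S_carrier submoduleE(4)[OF N] by auto
  then have "(u \<otimes>\<^bsub>R\<^esub> t) \<odot>\<^bsub>M\<^esub> m \<in> N"
    using u n x S_carrier by (simp add: smult_assoc1)
  then show "\<exists>u\<in>S. u \<odot>\<^bsub>M\<^esub> m \<in> N"
    using u n by (intro bexI[of _ "u \<otimes>\<^bsub>R\<^esub> t"]) auto
next
  assume "\<exists>u\<in>S. u \<odot>\<^bsub>M\<^esub> m \<in> N"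
  then obtain u where u: "u \<in> S" "u \<odot>\<^bsub>M\<^esub> m \<in> N" by auto
  then have "frac m s = frac (u \<odot>\<^bsub>M\<^esub> m) (u \<otimes>\<^bsub>R\<^esub> s)"
    using x by (simp add: frac_cancel)
  then show "frac m s \<in> loc_submodule S M N"
    using u x by (simp add: loc_submoduleI)
qed

lemma loc_submodule_submodule:
  assumes N: "submodule N R M"
  shows "submodule (loc_submodule S M N) LR LM"
proof -
  have c: "n \<in> carrier M" if "n \<in> N" for n using that submoduleE(1)[OF N] by auto
  have "subgroup (loc_submodule S M N) (add_monoid LM)"
  proof (rule LM.add.subgroupI)
    show "loc_submodule S M N \<subseteq> carrier LM"
      using c by (auto simp: loc_submodule_def)
    show "loc_submodule S M N \<noteq> {}"
      using submoduleE(2)[OF N] S_one loc_submoduleI by blast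
    show "\<ominus>\<^bsub>LM\<^esub> x \<in> loc_submodule S M N" if "x \<in> loc_submodule S M N" for x
    proof -
      from that obtain n s where "n \<in> N" "s \<in> S" "x = frac n s"
        by (auto simp: loc_submodule_def)
      then show ?thesis
        using c submoduleE(3)[OF N] by (simp add: a_inv_frac loc_submoduleI)
    qed
    fix x y assume "x \<in> loc_submodule S M N" "y \<in> loc_submodule S M N"
    then obtain m s n t where *: "m \<in> N" "s \<in> S" "n \<in> N" "t \<in> S" "x = frac m s" "y = frac n t"
      by (auto simp: loc_submodule_def)
    then have "t \<odot>\<^bsub>M\<^esub> m \<oplus>\<^bsub>M\<^esub> s \<odot>\<^bsub>M\<^esub> n \<in> N"
      using submoduleE(4,5)[OF N] S_carrier by auto
    with * show "x \<oplus>\<^bsub>LM\<^esub> y \<in> loc_submodule S M N"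
      using c by (simp add: add_frac loc_submoduleI)
  qed
  moreover have "a \<odot>\<^bsub>LM\<^esub> x \<in> loc_submodule S M N"
    if "a \<in> carrier LR" "x \<in> loc_submodule S M N" for a x
  proof -
    from that obtain r s n t where *: "r \<in> carrier R" "s \<in> S" "n \<in> N" "t \<in> S" 
      "a = rfrac r s" "x = frac n t"
      by (auto simp: loc_submodule_def carrier_LR_iff)
    then have "r \<odot>\<^bsub>M\<^esub> n \<in> N"
      using submoduleE(4)[OF N] by auto
    with * show ?thesis
      using c by (simp add: smult_frac loc_submoduleI)
  qed
  ultimately show ?thesis
    by (intro submodule.intro submodule_axioms.intro)
qed

end

section \<open>Graded submodules and graded prime ideals\<close>

context graded_ring
begin

lemma ring_component_subgroup: "g \<in> carrier G \<Longrightarrow> additive_subgroup (\<R> g) R"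
  using ring_direct_sum by (auto simp: is_direct_sum_def)

lemma ring_component_carrier: "g \<in> carrier G \<Longrightarrow> r \<in> \<R> g \<Longrightarrow> r \<in> carrier R"
  using additive_subgroup.a_subset[OF ring_component_subgroup] by blast

lemma ring_independent: "homogeneous_closed R (carrier G) \<R> {\<zero>\<^bsub>R\<^esub>}"
  using R.is_direct_sum_imp_independent[OF ring_direct_sum] .

lemma graded_module_ring_as_module: "graded_module G R \<R> (ring_as_module R) \<R>"
proof -
  have "is_direct_sum (ring_as_module R) (carrier G) \<R> (carrier (ring_as_module R))"
    using ring_direct_sum by (subst is_direct_sum_cong_structure[of _ R]) simp_all
  then show ?thesis
    using mult_degree
    by (intro graded_module.intro graded_module_axioms.intro graded_ring_axioms R.module_ring_as_module)
      auto
qed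

lemma graded_ideal_homogeneous_closed:
  assumes "graded_ideal G R \<R> I"
  shows "homogeneous_closed R (carrier G) \<R> I"
  using assms R.is_direct_sum_imp_homogeneous_closed[OF ring_component_subgroup ring_independent]
  by (auto simp: graded_ideal_def)

lemma graded_idealI:
  assumes "ideal I R" "homogeneous_closed R (carrier G) \<R> I"
  shows "graded_ideal G R \<R> I"
  using assms R.homogeneous_closed_imp_is_direct_sum[OF ring_direct_sum] ideal.axioms(1)
  by (auto simp: graded_ideal_def)

text \<open>Homogeneity of \<open>a\<close> is what makes \<open>p + Ra\<close> graded: if \<open>c\<close> is the sum of homogeneous
  \<open>c\<^sub>i\<close>, then \<open>ca\<close> is the sum of the homogeneous \<open>c\<^sub>i a\<close>.\<close>

lemma graded_ideal_adjoin:
  assumes p: "graded_ideal G R \<R> p" and a: "h \<in> carrier G" "a \<in> \<R> h"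
  shows "graded_ideal G R \<R> {x \<oplus>\<^bsub>R\<^esub> c \<otimes>\<^bsub>R\<^esub> a | x c. x \<in> p \<and> c \<in> carrier R}"
proof -
  define J where "J = {x \<oplus>\<^bsub>R\<^esub> c \<otimes>\<^bsub>R\<^esub> a | x c. x \<in> p \<and> c \<in> carrier R}"
  have ac: "a \<in> carrier R" using a ring_component_carrier by auto
  interpret p: ideal p R using p by (simp add: graded_ideal_def)
  have eq: "J = p <+>\<^bsub>R\<^esub> (PIdl\<^bsub>R\<^esub> a)"
    unfolding J_def by (auto simp: set_add_def' cgenideal_def)
  have J: "ideal J R"
    unfolding eq by (rule R.add_ideals[OF p.ideal_axioms R.cgenideal_ideal[OF ac]])
  interpret J: ideal J R by (rule J)
  have memJ: "x \<in> J" if "x \<in> p" for x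
    unfolding J_def using that ac p.a_subset by (intro CollectI exI[of _ x] exI[of _ "\<zero>\<^bsub>R\<^esub>"]) auto
  have memJ': "c \<otimes>\<^bsub>R\<^esub> a \<in> J" if "c \<in> carrier R" for c
    unfolding J_def using that ac p.zero_closed by (intro CollectI exI[of _ "\<zero>\<^bsub>R\<^esub>"] exI[of _ c]) auto
  have "is_direct_sum R (carrier G) (\<lambda>g. J \<inter> \<R> g) J"
  proof (rule R.is_direct_sum_subgroupI[OF ring_component_subgroup ring_independent])
    show "additive_subgroup J R" ..
    show "J \<subseteq> generate (add_monoid R) (\<Union>g\<in>carrier G. J \<inter> \<R> g)" (is "_ \<subseteq> ?H")
    proof
      interpret H: additive_subgroup ?H R
        using J.a_subset by (intro additive_subgroup.intro R.add.generate_is_subgroup) blast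
      fix y assume "y \<in> J"
      then obtain x c where y: "x \<in> p" "c \<in> carrier R" "y = x \<oplus>\<^bsub>R\<^esub> c \<otimes>\<^bsub>R\<^esub> a"
        unfolding J_def by blast
      have "is_direct_sum R (carrier G) (\<lambda>g. p \<inter> \<R> g) p"
        using p by (simp add: graded_ideal_def)
      from R.direct_sum_finite_sum[OF this y(1)] obtain F f where
        f: "finite F" "F \<subseteq> carrier G" "f \<in> Pi F (\<lambda>g. p \<inter> \<R> g)" "x = finsum R f F" .
      have "f \<in> F \<rightarrow> ?H"
        using f memJ by (intro Pi_I generate.incl) blast
      then have x: "x \<in> ?H"
        unfolding f(4) by (intro H.finsum_mem R.abelian_group_axioms)
      from R.direct_sum_finite_sum[OF ring_direct_sum y(2)] obtain K k where
        k: "finite K" "K \<subseteq> carrier G" "k \<in> Pi K \<R>" "c = finsum R k K" .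
      have kc: "k \<in> K \<rightarrow> carrier R"
        using k ring_component_carrier by blast
      have "k i \<otimes>\<^bsub>R\<^esub> a \<in> ?H" if "i \<in> K" for i
      proof (rule generate.incl)
        have "k i \<otimes>\<^bsub>R\<^esub> a \<in> J \<inter> \<R> (i \<otimes>\<^bsub>G\<^esub> h)"
          using that kc k a memJ' mult_degree by blast
        then show "k i \<otimes>\<^bsub>R\<^esub> a \<in> (\<Union>g\<in>carrier G. J \<inter> \<R> g)"
          using that k a G.m_closed by blast
      qed
      then have "finsum R (\<lambda>i. k i \<otimes>\<^bsub>R\<^esub> a) K \<in> ?H"
        by (intro H.finsum_mem R.abelian_group_axioms) auto
      then have "c \<otimes>\<^bsub>R\<^esub> a \<in> ?H"
        unfolding k(4) using R.finsum_ldistr[OF k(1) ac kc] by simp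
      with x show "y \<in> ?H" unfolding y(3) by (rule H.a_closed)
    qed
  qed
  with J show ?thesis unfolding J_def[symmetric] by (simp add: graded_ideal_def)
qed

text \<open>Zorn's lemma yields a graded ideal \<open>p\<close> maximal among those that contain \<open>I\<close> and avoid \<open>S\<close>.
  If \<open>a\<close> and \<open>b\<close> are homogeneous and outside \<open>p\<close>, then by maximality both \<open>p + Ra\<close> and
  \<open>p + Rb\<close> meet \<open>S\<close>; the product of the two elements of \<open>S\<close> lies in \<open>p + Rab\<close>, so that
  \<open>ab\<close> is outside \<open>p\<close>.\<close>

lemma exists_graded_prime_ideal_avoiding:
  assumes I: "graded_ideal G R \<R> I" and S: "submonoid S R" "S \<inter> I = {}"
  obtains p where "graded_prime_ideal G R \<R> p" "I \<subseteq> p" "S \<inter> p = {}"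
proof -
  define \<A> where "\<A> = {J. graded_ideal G R \<R> J \<and> I \<subseteq> J \<and> S \<inter> J = {}}"
  have "\<exists>p\<in>\<A>. \<forall>X\<in>\<A>. p \<subseteq> X \<longrightarrow> X = p"
  proof (rule subset_Zorn_nonempty)
    show "\<A> \<noteq> {}" using I S by (auto simp: \<A>_def)
    fix C assume C: "C \<noteq> {}" "subset.chain \<A> C"
    then have gr: "graded_ideal G R \<R> J \<and> I \<subseteq> J \<and> S \<inter> J = {}" if "J \<in> C" for J
      using that by (auto simp: pred_on.chain_def \<A>_def)
    have "subset.chain {I. ideal I R} C"
      using C(2) gr by (auto simp: pred_on.chain_def graded_ideal_def)
    from R.chain_Union_is_ideal[OF this] have "ideal (\<Union>C) R"
      using C by simp
    moreover have "homogeneous_closed R (carrier G) \<R> (\<Union>C)"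
      unfolding homogeneous_closed_def
    proof (intro allI impI ballI, elim conjE)
      fix F f i assume F: "finite F" "F \<subseteq> carrier G" "f \<in> Pi F \<R>" "finsum R f F \<in> \<Union>C" "i \<in> F"
      then obtain J where J: "J \<in> C" "finsum R f F \<in> J" by blast
      have "homogeneous_closed R (carrier G) \<R> J"
        using gr[OF J(1)] graded_ideal_homogeneous_closed by blast
      from homogeneous_closedD[OF this F(1-3) J(2) F(5)] J show "f i \<in> \<Union>C" by blast
    qed
    ultimately have "graded_ideal G R \<R> (\<Union>C)" by (rule graded_idealI)
    moreover have "I \<subseteq> \<Union>C" "S \<inter> \<Union>C = {}" using gr C(1) by blast+
    ultimately show "\<Union>C \<in> \<A>" by (simp add: \<A>_def)
  qed
  then obtain p where p: "p \<in> \<A>" and max: "\<And>X. X \<in> \<A> \<Longrightarrow> p \<subseteq> X \<Longrightarrow> X = p" by blast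
  have gp: "graded_ideal G R \<R> p" and Ip: "I \<subseteq> p" and Sp: "S \<inter> p = {}"
    using p by (auto simp: \<A>_def)
  interpret p: ideal p R using gp by (simp add: graded_ideal_def)
  have one: "\<one>\<^bsub>R\<^esub> \<in> S" and Smult: "\<And>s t. s \<in> S \<Longrightarrow> t \<in> S \<Longrightarrow> s \<otimes>\<^bsub>R\<^esub> t \<in> S"
    using S(1) submonoid.one_closed submonoid.m_closed by auto
  have meets: "\<exists>x\<in>p. \<exists>c\<in>carrier R. x \<oplus>\<^bsub>R\<^esub> c \<otimes>\<^bsub>R\<^esub> a \<in> S"
    if a: "a \<in> homogeneous G \<R>" "a \<notin> p" for a
  proof -
    obtain h where h: "h \<in> carrier G" "a \<in> \<R> h" using a by (auto simp: homogeneous_def)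
    have ac: "a \<in> carrier R" using h ring_component_carrier by auto
    let ?J = "{x \<oplus>\<^bsub>R\<^esub> c \<otimes>\<^bsub>R\<^esub> a | x c. x \<in> p \<and> c \<in> carrier R}"
    have "x \<in> ?J" if "x \<in> p" for x
      using that ac p.a_subset by (intro CollectI exI[of _ x] exI[of _ "\<zero>\<^bsub>R\<^esub>"]) auto
    then have pJ: "p \<subseteq> ?J" by blast
    have "a \<in> ?J"
      using ac p.zero_closed by (intro CollectI exI[of _ "\<zero>\<^bsub>R\<^esub>"] exI[of _ "\<one>\<^bsub>R\<^esub>"]) auto
    with a(2) have "?J \<noteq> p" by blast
    with max pJ have "?J \<notin> \<A>" by blast
    moreover have "graded_ideal G R \<R> ?J" by (rule graded_ideal_adjoin[OF gp h])
    moreover have "I \<subseteq> ?J" using Ip pJ by blast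
    ultimately have "S \<inter> ?J \<noteq> {}" by (simp add: \<A>_def)
    then show ?thesis by blast
  qed
  have "a \<in> p \<or> b \<in> p"
    if ab: "a \<in> homogeneous G \<R>" "b \<in> homogeneous G \<R>" "a \<otimes>\<^bsub>R\<^esub> b \<in> p" for a b
  proof (rule ccontr)
    assume "\<not> ?thesis"
    with meets ab obtain x c y d where
      *: "x \<in> p" "c \<in> carrier R" "x \<oplus>\<^bsub>R\<^esub> c \<otimes>\<^bsub>R\<^esub> a \<in> S" 
      "y \<in> p" "d \<in> carrier R" "y \<oplus>\<^bsub>R\<^esub> d \<otimes>\<^bsub>R\<^esub> b \<in> S" by metis
    have c: "a \<in> carrier R" "b \<in> carrier R" "x \<in> carrier R" "y \<in> carrier R"
      using ab ring_component_carrier * p.a_subset by (auto simp: homogeneous_def)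
    have "(x \<oplus>\<^bsub>R\<^esub> c \<otimes>\<^bsub>R\<^esub> a) \<otimes>\<^bsub>R\<^esub> (y \<oplus>\<^bsub>R\<^esub> d \<otimes>\<^bsub>R\<^esub> b) =
      x \<otimes>\<^bsub>R\<^esub> (y \<oplus>\<^bsub>R\<^esub> d \<otimes>\<^bsub>R\<^esub> b) \<oplus>\<^bsub>R\<^esub> ((c \<otimes>\<^bsub>R\<^esub> a) \<otimes>\<^bsub>R\<^esub> y \<oplus>\<^bsub>R\<^esub> (c \<otimes>\<^bsub>R\<^esub> d) \<otimes>\<^bsub>R\<^esub> (a \<otimes>\<^bsub>R\<^esub> b))"
      using c *(2,5) by (simp add: R.l_distr R.r_distr R.m_ac R.a_ac)
    also have "\<dots> \<in> p"
    proof (intro p.a_closed)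
      show "x \<otimes>\<^bsub>R\<^esub> (y \<oplus>\<^bsub>R\<^esub> d \<otimes>\<^bsub>R\<^esub> b) \<in> p" using c * by (intro p.I_r_closed) auto
      show "(c \<otimes>\<^bsub>R\<^esub> a) \<otimes>\<^bsub>R\<^esub> y \<in> p" using c * by (intro p.I_l_closed) auto
      show "(c \<otimes>\<^bsub>R\<^esub> d) \<otimes>\<^bsub>R\<^esub> (a \<otimes>\<^bsub>R\<^esub> b) \<in> p" using c * by (intro p.I_l_closed[OF ab(3)]) auto
    qed
    finally show False using Smult *(3,6) Sp by blast
  qed
  moreover have "p \<noteq> carrier R" using one Sp by auto
  ultimately have "graded_prime_ideal G R \<R> p"
    using gp by (simp add: graded_prime_ideal_def)
  with Ip Sp show thesis by (rule that[rotated 1]) 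
qed

end

context graded_module
begin

lemma component_subgroup: "g \<in> carrier G \<Longrightarrow> additive_subgroup (\<M> g) M"
  using module_direct_sum by (auto simp: is_direct_sum_def)

lemma component_carrier: "g \<in> carrier G \<Longrightarrow> m \<in> \<M> g \<Longrightarrow> m \<in> carrier M"
  using additive_subgroup.a_subset[OF component_subgroup] by blast

lemma module_independent: "homogeneous_closed M (carrier G) \<M> {\<zero>\<^bsub>M\<^esub>}"
  using M.is_direct_sum_imp_independent[OF module_direct_sum] .

lemma graded_submodule_homogeneous_closed:
  assumes "graded_submodule G R M \<M> N"
  shows "homogeneous_closed M (carrier G) \<M> N"
  using assms M.is_direct_sum_imp_homogeneous_closed[OF component_subgroup module_independent]
  by (auto simp: graded_submodule_def)

lemma graded_submoduleI:
  assumes "submodule N R M" "homogeneous_closed M (carrier G) \<M> N"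
  shows "graded_submodule G R M \<M> N"
  using assms M.homogeneous_closed_imp_is_direct_sum[OF module_direct_sum]
  by (auto simp: graded_submodule_def submodule_def additive_subgroup_def)

lemma smult_hom: "a \<in> carrier R \<Longrightarrow> (\<lambda>x. a \<odot>\<^bsub>M\<^esub> x) \<in> hom (add_monoid M) (add_monoid M)"
  by (auto simp: hom_def smult_r_distr)

lemma smult_hom': "x \<in> carrier M \<Longrightarrow> (\<lambda>a. a \<odot>\<^bsub>M\<^esub> x) \<in> hom (add_monoid R) (add_monoid M)"
  by (auto simp: hom_def smult_l_distr)

lemma homogeneous_closed_smult_vimage:
  assumes N: "homogeneous_closed M (carrier G) \<M> N" and s: "k \<in> carrier G" "s \<in> \<R> k"
  shows "homogeneous_closed M (carrier G) \<M> {x \<in> carrier M. s \<odot>\<^bsub>M\<^esub> x \<in> N}"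
proof (rule homogeneous_closed_vimage[OF M.abelian_group_axioms M.abelian_group_axioms])
  show "(\<lambda>x. s \<odot>\<^bsub>M\<^esub> x) \<in> hom (add_monoid M) (add_monoid M)"
    using s ring_component_carrier by (intro smult_hom)
  show "inj_on (\<lambda>g. k \<otimes>\<^bsub>G\<^esub> g) (carrier G)"
    using s by (simp add: inj_on_def)
qed (use s N component_carrier smult_degree in auto)

text \<open>For homogeneous \<open>x\<close>, the map \<open>a \<mapsto> ax\<close> shifts degrees injectively, hence carries the
  components of \<open>a\<close> to those of \<open>ax\<close>; sums of homogeneous elements give all of \<open>M\<close>.\<close>

lemma module_colon_graded_ideal:
  assumes N: "graded_submodule G R M \<M> N"
  shows "graded_ideal G R \<R> (module_colon R M N)"
proof (rule graded_idealI)
  have sub: "submodule N R M" using N by (simp add: graded_submodule_def)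
  show "ideal (module_colon R M N) R"
  proof (rule idealI)
    show "subgroup (module_colon R M N) (add_monoid R)"
    proof (rule R.add.subgroupI)
      have "\<zero>\<^bsub>M\<^esub> \<in> N" using sub by (auto simp: submodule_def dest: subgroup.one_closed)
      then have "\<zero>\<^bsub>R\<^esub> \<in> module_colon R M N" by (simp add: module_colon_def)
      then show "module_colon R M N \<noteq> {}" by blast
    qed (auto simp: module_colon_def smult_l_minus smult_l_distr submoduleE[OF sub])
  qed (auto simp: module_colon_def smult_assoc1 submoduleE[OF sub] R.ring_axioms R.m_comm)
  show "homogeneous_closed R (carrier G) \<R> (module_colon R M N)"
    unfolding homogeneous_closed_def
  proof (intro allI impI ballI, elim conjE)
    fix F f i
    assume F: "finite F" "F \<subseteq> carrier G" "f \<in> Pi F \<R>" "finsum R f F \<in> module_colon R M N"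
      and i: "i \<in> F"
    have fi: "f i \<in> carrier R" using F i ring_component_carrier by blast
    have hom: "f i \<odot>\<^bsub>M\<^esub> x \<in> N" if x: "h \<in> carrier G" "x \<in> \<M> h" for x h
    proof -
      have xc: "x \<in> carrier M" using x component_carrier by auto
      have "homogeneous_closed R (carrier G) \<R> {a \<in> carrier R. a \<odot>\<^bsub>M\<^esub> x \<in> N}"
      proof (rule homogeneous_closed_vimage[OF R.abelian_group_axioms M.abelian_group_axioms])
        show "(\<lambda>a. a \<odot>\<^bsub>M\<^esub> x) \<in> hom (add_monoid R) (add_monoid M)" by (rule smult_hom'[OF xc])
        show "inj_on (\<lambda>g. g \<otimes>\<^bsub>G\<^esub> h) (carrier G)" using x by (simp add: inj_on_def)
        show "homogeneous_closed M (carrier G) \<M> N"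
          using N graded_submodule_homogeneous_closed by blast
      qed (use x smult_degree ring_component_carrier in auto)
      moreover have "finsum R f F \<in> {a \<in> carrier R. a \<odot>\<^bsub>M\<^esub> x \<in> N}"
        using F(4) xc by (simp add: module_colon_def)
      ultimately show ?thesis
        using homogeneous_closedD[OF _ F(1-3) _ i] by blast
    qed
    have "f i \<odot>\<^bsub>M\<^esub> m \<in> N" if "m \<in> carrier M" for m
    proof -
      from M.direct_sum_finite_sum[OF module_direct_sum that] obtain K k where
        k: "finite K" "K \<subseteq> carrier G" "k \<in> Pi K \<M>" "m = finsum M k K" .
      have kc: "k \<in> K \<rightarrow> carrier M" using k component_carrier by blast
      interpret N: additive_subgroup N M
        using sub by (simp add: submodule_def additive_subgroup_def)
      have "finsum M (\<lambda>j. f i \<odot>\<^bsub>M\<^esub> k j) K \<in> N"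
        using hom k by (intro N.finsum_mem M.abelian_group_axioms) blast
      then show ?thesis unfolding k(4) using finsum_smult_ldistr[OF k(1) fi kc] by simp
    qed
    with fi show "f i \<in> module_colon R M N" by (simp add: module_colon_def)
  qed
qed

text \<open>The definition of a graded prime submodule only covers homogeneous \<open>x\<close>.  As \<open>s\<close> is
  homogeneous, the components of \<open>sx\<close> are the products of \<open>s\<close> with those of \<open>x\<close>, and the
  general case follows componentwise.\<close>

lemma graded_prime_submodule_cancel:
  assumes P: "graded_prime_submodule G R \<R> M \<M> P"
    and s: "s \<in> homogeneous G \<R>" "s \<notin> module_colon R M P"
    and x: "x \<in> carrier M" "s \<odot>\<^bsub>M\<^esub> x \<in> P"
  shows "x \<in> P"
proof -
  have gr: "graded_submodule G R M \<M> P" using P by (simp add: graded_prime_submodule_def)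
  obtain k where k: "k \<in> carrier G" "s \<in> \<R> k" using s by (auto simp: homogeneous_def)
  have closed: "homogeneous_closed M (carrier G) \<M> {x \<in> carrier M. s \<odot>\<^bsub>M\<^esub> x \<in> P}"
    by (rule homogeneous_closed_smult_vimage[OF graded_submodule_homogeneous_closed[OF gr] k])
  from M.direct_sum_finite_sum[OF module_direct_sum x(1)] obtain F f where
    f: "finite F" "F \<subseteq> carrier G" "f \<in> Pi F \<M>" "x = finsum M f F" .
  interpret P: additive_subgroup P M
    using gr by (simp add: graded_submodule_def submodule_def additive_subgroup_def)
  have "f i \<in> P" if "i \<in> F" for i
  proof -
    have "s \<odot>\<^bsub>M\<^esub> f i \<in> P"
      using homogeneous_closedD[OF closed f(1-3) _ that] x f(4) by blast
    moreover have "f i \<in> homogeneous G \<M>" using f that by (auto simp: homogeneous_def)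
    ultimately show ?thesis using P s by (auto simp: graded_prime_submodule_def)
  qed
  then show ?thesis
    unfolding f(4) by (intro P.finsum_mem M.abelian_group_axioms) auto
qed

end

section \<open>The grading of a localization\<close>

locale graded_localization = graded_module G R \<R> M \<M> + module_localization R M S
  for G :: "('g, 'x) monoid_scheme" and R :: "('r, 'y) ring_scheme" and \<R> :: "'g \<Rightarrow> 'r set"
    and M :: "('r, 'm, 'z) module_scheme" and \<M> :: "'g \<Rightarrow> 'm set" and S :: "'r set" +
  assumes S_homogeneous: "S \<subseteq> homogeneous G \<R>" and zero_notin_S: "\<zero>\<^bsub>R\<^esub> \<notin> S"
begin

abbreviation LRg :: "'g \<Rightarrow> ('r \<times> 'r) set set" where "LRg \<equiv> loc_ring_grading G R \<R> S"
abbreviation LMg :: "'g \<Rightarrow> ('m \<times> 'r) set set" where "LMg \<equiv> loc_module_grading G \<R> S M \<M>"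

lemma S_degree:
  assumes "s \<in> S"
  obtains k where "k \<in> carrier G" "s \<in> \<R> k"
  using assms S_homogeneous by (auto simp: homogeneous_def)

text \<open>The group \<open>G\<close> may be noncommutative, but \<open>R\<close> is commutative: \<open>st = ts\<close> lies in the components
  of degree \<open>kl\<close> and \<open>lk\<close>, and it is nonzero because \<open>0 \<notin> S\<close>.  So the common
  denominator \<open>st\<close> of two fractions has one degree, whichever fraction is expanded first.\<close>

lemma S_degrees_commute:
  assumes "s \<in> S" "s \<in> \<R> k" "t \<in> S" "t \<in> \<R> l" "k \<in> carrier G" "l \<in> carrier G"
  shows "k \<otimes>\<^bsub>G\<^esub> l = l \<otimes>\<^bsub>G\<^esub> k"
proof (rule R.degree_unique[OF ring_component_subgroup ring_independent])
  show "s \<otimes>\<^bsub>R\<^esub> t \<in> \<R> (k \<otimes>\<^bsub>G\<^esub> l)" using assms mult_degree by auto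
  have "t \<otimes>\<^bsub>R\<^esub> s \<in> \<R> (l \<otimes>\<^bsub>G\<^esub> k)" using assms mult_degree by auto
  then show "s \<otimes>\<^bsub>R\<^esub> t \<in> \<R> (l \<otimes>\<^bsub>G\<^esub> k)" using assms S_carrier R.m_comm by simp
  show "s \<otimes>\<^bsub>R\<^esub> t \<noteq> \<zero>\<^bsub>R\<^esub>" using assms S_mult zero_notin_S by metis
qed (use assms in auto)

lemma frac_mem_LMg:
  assumes "h \<in> carrier G" "m \<in> \<M> h" "k \<in> carrier G" "s \<in> S" "s \<in> \<R> k"
  shows "frac m s \<in> LMg (inv\<^bsub>G\<^esub> k \<otimes>\<^bsub>G\<^esub> h)"
  using assms unfolding loc_module_grading_def by blast

lemma frac_mem_LMg_shifted:
  assumes "g \<in> carrier G" "m \<in> \<M> (k \<otimes>\<^bsub>G\<^esub> g)" "k \<in> carrier G" "s \<in> S" "s \<in> \<R> k"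
  shows "frac m s \<in> LMg g"
  using frac_mem_LMg[of "k \<otimes>\<^bsub>G\<^esub> g" m k s] assms by (simp add: G.m_assoc[symmetric])

lemma LMg_cases:
  assumes "g \<in> carrier G" "x \<in> LMg g"
  obtains m k s where "m \<in> \<M> (k \<otimes>\<^bsub>G\<^esub> g)" "k \<in> carrier G" "s \<in> S" "s \<in> \<R> k" "x = frac m s"
proof -
  from assms(2) obtain m s h k where *: "x = frac m s" "h \<in> carrier G" "k \<in> carrier G" "m \<in> \<M> h"
    "s \<in> S" "s \<in> \<R> k" "g = inv\<^bsub>G\<^esub> k \<otimes>\<^bsub>G\<^esub> h"
    unfolding loc_module_grading_def by blast
  then have kg: "k \<otimes>\<^bsub>G\<^esub> g = h" by (simp add: G.m_assoc[symmetric])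
  have "m \<in> \<M> (k \<otimes>\<^bsub>G\<^esub> g)" unfolding kg by (rule *(4))
  with *(1,3,5,6) show thesis by (intro that)
qed

lemma homogeneous_LM_iff:
  "x \<in> homogeneous G LMg \<longleftrightarrow> (\<exists>m\<in>homogeneous G \<M>. \<exists>s\<in>S. x = frac m s)"
proof
  assume "x \<in> homogeneous G LMg"
  then obtain g where "g \<in> carrier G" "x \<in> LMg g" by (auto simp: homogeneous_def)
  then obtain m k s where "m \<in> \<M> (k \<otimes>\<^bsub>G\<^esub> g)" "k \<in> carrier G" "s \<in> S" "x = frac m s"
    by (rule LMg_cases)
  with \<open>g \<in> carrier G\<close> show "\<exists>m\<in>homogeneous G \<M>. \<exists>s\<in>S. x = frac m s"
    unfolding homogeneous_def by blast
next
  assume "\<exists>m\<in>homogeneous G \<M>. \<exists>s\<in>S. x = frac m s"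
  then obtain m s h where *: "h \<in> carrier G" "m \<in> \<M> h" "s \<in> S" "x = frac m s"
    by (auto simp: homogeneous_def)
  obtain k where "k \<in> carrier G" "s \<in> \<R> k" using S_degree *(3) .
  with * frac_mem_LMg[of h m k s] show "x \<in> homogeneous G LMg"
    unfolding homogeneous_def by (intro UN_I[of "inv\<^bsub>G\<^esub> k \<otimes>\<^bsub>G\<^esub> h"]) auto
qed

text \<open>Both \<open>m/s = (tm)/(ts)\<close> and \<open>n/t = (sn)/(st)\<close> keep their degrees, and the two denominators
  agree also in degree because \<open>kl = lk\<close>.\<close>

lemma common_denominator:
  assumes "finite F" "\<And>i. i \<in> F \<Longrightarrow> d i \<in> carrier G" "\<And>i. i \<in> F \<Longrightarrow> x i \<in> LMg (d i)"
  shows "\<exists>k\<in>carrier G. \<exists>s\<in>S \<inter> \<R> k. \<exists>m. \<forall>i\<in>F. m i \<in> \<M> (k \<otimes>\<^bsub>G\<^esub> d i) \<and> x i = frac (m i) s"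
  using assms
proof (induction F rule: finite_induct)
  case empty
  obtain k where "k \<in> carrier G" "\<one>\<^bsub>R\<^esub> \<in> \<R> k" using S_degree[OF S_one] .
  then show ?case using S_one by blast
next
  case (insert j F)
  from insert.IH insert.prems obtain k s m where IH: "k \<in> carrier G" "s \<in> S" "s \<in> \<R> k"
    "\<And>i. i \<in> F \<Longrightarrow> m i \<in> \<M> (k \<otimes>\<^bsub>G\<^esub> d i) \<and> x i = frac (m i) s" by fastforce
  from insert.prems have "d j \<in> carrier G" "x j \<in> LMg (d j)" by auto
  then obtain n l t where j: "n \<in> \<M> (l \<otimes>\<^bsub>G\<^esub> d j)" "l \<in> carrier G" "t \<in> S" "t \<in> \<R> l" "x j = frac n t"
    by (rule LMg_cases)
  have comm: "k \<otimes>\<^bsub>G\<^esub> l = l \<otimes>\<^bsub>G\<^esub> k"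
    using S_degrees_commute IH j by blast
  let ?m = "\<lambda>i. if i = j then s \<odot>\<^bsub>M\<^esub> n else t \<odot>\<^bsub>M\<^esub> m i"
  have "?m i \<in> \<M> ((l \<otimes>\<^bsub>G\<^esub> k) \<otimes>\<^bsub>G\<^esub> d i) \<and> x i = frac (?m i) (t \<otimes>\<^bsub>R\<^esub> s)" if i: "i \<in> insert j F" for i
  proof (cases "i = j")
    case True
    have "s \<odot>\<^bsub>M\<^esub> n \<in> \<M> (k \<otimes>\<^bsub>G\<^esub> (l \<otimes>\<^bsub>G\<^esub> d j))"
      using IH j insert.prems by (intro smult_degree) auto
    then have "s \<odot>\<^bsub>M\<^esub> n \<in> \<M> ((l \<otimes>\<^bsub>G\<^esub> k) \<otimes>\<^bsub>G\<^esub> d j)"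
      using IH j insert.prems by (simp add: G.m_assoc[symmetric] comm)
    moreover have "n \<in> carrier M" using j insert.prems by (intro component_carrier) auto
    then have "x j = frac (s \<odot>\<^bsub>M\<^esub> n) (s \<otimes>\<^bsub>R\<^esub> t)"
      using j IH by (simp add: frac_cancel)
    ultimately show ?thesis using True IH j S_carrier by (simp add: R.m_comm)
  next
    case False
    then have F: "i \<in> F" using i by simp
    have "t \<odot>\<^bsub>M\<^esub> m i \<in> \<M> (l \<otimes>\<^bsub>G\<^esub> (k \<otimes>\<^bsub>G\<^esub> d i))"
      using IH j insert.prems F by (intro smult_degree) auto
    moreover have "m i \<in> carrier M"
      using IH(1) IH(4)[OF F] insert.prems F component_carrier[of "k \<otimes>\<^bsub>G\<^esub> d i" "m i"] by simp
    ultimately show ?thesis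
      using IH(1,2) IH(4)[OF F] j insert.prems F False by (simp add: G.m_assoc frac_cancel)
  qed
  moreover have "t \<otimes>\<^bsub>R\<^esub> s \<in> S \<inter> \<R> (l \<otimes>\<^bsub>G\<^esub> k)"
    using IH j mult_degree by auto
  ultimately show ?case
    using IH(1) j(2) by (intro bexI[of _ "l \<otimes>\<^bsub>G\<^esub> k"] bexI[of _ "t \<otimes>\<^bsub>R\<^esub> s"] exI[of _ ?m]) auto
qed

lemma shifted_component_carrier:
  "\<lbrakk>m \<in> \<M> (k \<otimes>\<^bsub>G\<^esub> g); k \<in> carrier G; g \<in> carrier G\<rbrakk> \<Longrightarrow> m \<in> carrier M"
  by (rule component_carrier[OF G.m_closed])

lemma LM_component_subgroup:
  assumes g: "g \<in> carrier G"
  shows "additive_subgroup (LMg g) LM"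
proof (rule additive_subgroup.intro, rule LM.add.subgroupI)
  note comp = component_subgroup[OF G.m_closed[OF _ g]]
  show "LMg g \<subseteq> carrier LM"
  proof
    fix x assume "x \<in> LMg g"
    with g obtain m k s where "m \<in> \<M> (k \<otimes>\<^bsub>G\<^esub> g)" "k \<in> carrier G" "s \<in> S" "s \<in> \<R> k" "x = frac m s"
      by (rule LMg_cases)
    with g show "x \<in> carrier LM" using shifted_component_carrier by auto
  qed
  obtain k where "k \<in> carrier G" "\<one>\<^bsub>R\<^esub> \<in> \<R> k" using S_degree[OF S_one] .
  then have "frac \<zero>\<^bsub>M\<^esub> \<one>\<^bsub>R\<^esub> \<in> LMg g"
    using g by (intro frac_mem_LMg_shifted[of _ _ k] additive_subgroup.zero_closed[OF comp]) auto
  then show "LMg g \<noteq> {}" by blast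
  show "\<ominus>\<^bsub>LM\<^esub> x \<in> LMg g" if "x \<in> LMg g" for x
  proof -
    from g that obtain m k s where
      *: "m \<in> \<M> (k \<otimes>\<^bsub>G\<^esub> g)" "k \<in> carrier G" "s \<in> S" "s \<in> \<R> k" "x = frac m s"
      by (rule LMg_cases)
    then have "m \<in> carrier M" using g shifted_component_carrier by auto
    moreover have "\<ominus>\<^bsub>M\<^esub> m \<in> \<M> (k \<otimes>\<^bsub>G\<^esub> g)"
      using * additive_subgroup.a_inv_closed[OF comp] M.abelian_group_axioms by auto
    ultimately show ?thesis
      using * g frac_mem_LMg_shifted by (simp add: a_inv_frac)
  qed
  fix x y assume "x \<in> LMg g" "y \<in> LMg g"
  \<comment> \<open>the two summands as a family indexed by truth values\<close>
  then have "(if i then x else y) \<in> LMg g" for i by simp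
  with common_denominator[of UNIV "\<lambda>_. g" "\<lambda>i. if i then x else y"] g
  obtain k s m where k: "k \<in> carrier G" "s \<in> S" "s \<in> \<R> k"
    "\<And>i. m i \<in> \<M> (k \<otimes>\<^bsub>G\<^esub> g) \<and> (if i then x else y) = frac (m i) s"
    by auto
  have *: "m True \<in> \<M> (k \<otimes>\<^bsub>G\<^esub> g)" "m False \<in> \<M> (k \<otimes>\<^bsub>G\<^esub> g)" using k(4) by auto
  have xy: "x = frac (m True) s" using k(4)[of True] by (simp only: if_True simp_thms)
  have "y = frac (m False) s" using k(4)[of False] by (simp only: if_False simp_thms)
  note * = * xy this
  from * have "m True \<in> carrier M" "m False \<in> carrier M" "m True \<oplus>\<^bsub>M\<^esub> m False \<in> \<M> (k \<otimes>\<^bsub>G\<^esub> g)"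
    using k(1) g shifted_component_carrier additive_subgroup.a_closed[OF comp] by auto
  then show "x \<oplus>\<^bsub>LM\<^esub> y \<in> LMg g"
    using * k(1-3) g frac_mem_LMg_shifted by (simp add: add_frac_same)
qed

text \<open>Over a common denominator a relation between homogeneous fractions becomes, after
  multiplication by some \<open>u \<in> S\<close>, a relation between homogeneous elements of \<open>M\<close>, where all
  terms vanish.\<close>

lemma LM_independent: "homogeneous_closed LM (carrier G) LMg {\<zero>\<^bsub>LM\<^esub>}"
  unfolding homogeneous_closed_def
proof (intro allI impI ballI, elim conjE)
  fix F f i
  assume F: "finite F" "F \<subseteq> carrier G" "f \<in> Pi F LMg" "finsum LM f F \<in> {\<zero>\<^bsub>LM\<^esub>}" and i: "i \<in> F"
  from common_denominator[of F "\<lambda>i. i" f] F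
  obtain k s m where k: "k \<in> carrier G" "s \<in> S" "s \<in> \<R> k"
    and m: "\<And>i. i \<in> F \<Longrightarrow> m i \<in> \<M> (k \<otimes>\<^bsub>G\<^esub> i)" "\<And>i. i \<in> F \<Longrightarrow> f i = frac (m i) s"
    by blast
  have mc: "m j \<in> carrier M" if "j \<in> F" for j
    using that m(1) k F component_carrier by blast
  have "finsum LM f F = finsum LM (\<lambda>i. frac (m i) s) F"
    using m(2) mc k by (intro LM.finsum_cong') auto
  also have "\<dots> = frac (finsum M m F) s"
    using mc k by (intro finsum_frac) auto
  finally have "frac (finsum M m F) s = \<zero>\<^bsub>LM\<^esub>" using F(4) by simp
  moreover have fc: "finsum M m F \<in> carrier M" using mc by (intro M.finsum_closed) auto
  ultimately obtain u where u: "u \<in> S" "u \<odot>\<^bsub>M\<^esub> finsum M m F = \<zero>\<^bsub>M\<^esub>"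
    using k by (auto simp: frac_eq_zero_iff)
  obtain l where l: "l \<in> carrier G" "u \<in> \<R> l" using S_degree u(1) .
  have "homogeneous_closed M (carrier G) (\<lambda>i. \<M> (k \<otimes>\<^bsub>G\<^esub> i)) {x \<in> carrier M. u \<odot>\<^bsub>M\<^esub> x \<in> {\<zero>\<^bsub>M\<^esub>}}"
  proof (rule homogeneous_closed_vimage[OF M.abelian_group_axioms M.abelian_group_axioms])
    show "(\<lambda>x. u \<odot>\<^bsub>M\<^esub> x) \<in> hom (add_monoid M) (add_monoid M)"
      using u S_carrier by (intro smult_hom)
    show "inj_on (\<lambda>i. l \<otimes>\<^bsub>G\<^esub> (k \<otimes>\<^bsub>G\<^esub> i)) (carrier G)"
      using k l by (simp add: inj_on_def)
    show "\<M> (k \<otimes>\<^bsub>G\<^esub> i) \<subseteq> carrier M" if "i \<in> carrier G" for i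
      using that k component_carrier[of "k \<otimes>\<^bsub>G\<^esub> i"] by auto
    show "homogeneous_closed M (carrier G) \<M> {\<zero>\<^bsub>M\<^esub>}" by (rule module_independent)
  qed (use k l component_carrier smult_degree in auto)
  then have "m i \<in> {x \<in> carrier M. u \<odot>\<^bsub>M\<^esub> x \<in> {\<zero>\<^bsub>M\<^esub>}}"
    using homogeneous_closedD[of M "carrier G" "\<lambda>i. \<M> (k \<otimes>\<^bsub>G\<^esub> i)" _ F m i] F m(1) i u fc by blast
  then show "f i \<in> {\<zero>\<^bsub>LM\<^esub>}"
    using m(2)[OF i] u k by (auto simp: frac_eq_zero_iff)
qed

text \<open>If \<open>n\<close> is the sum of its components \<open>n\<^sub>i \<in> N\<close>, then \<open>n/s\<close> is the sum of the homogeneous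
  fractions \<open>n\<^sub>i/s\<close>.\<close>

lemma loc_graded_submodule:
  assumes N: "graded_submodule G R M \<M> N"
  shows "graded_submodule G LR LM LMg (loc_submodule S M N)"
proof -
  have sub: "submodule N R M" and dir: "is_direct_sum M (carrier G) (\<lambda>g. N \<inter> \<M> g) N"
    using N by (auto simp: graded_submodule_def)
  let ?L = "loc_submodule S M N" and ?H = "generate (add_monoid LM) (\<Union>g\<in>carrier G. loc_submodule S M N \<inter> LMg g)"
  have subL: "submodule ?L LR LM" by (rule loc_submodule_submodule[OF sub])
  then have asub: "additive_subgroup ?L LM" by (simp add: submodule_def additive_subgroup_def)
  have "is_direct_sum LM (carrier G) (\<lambda>g. ?L \<inter> LMg g) ?L"
  proof (rule LM.is_direct_sum_subgroupI[OF LM_component_subgroup LM_independent asub])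
    show "?L \<subseteq> ?H"
    proof
      interpret H: additive_subgroup ?H LM
        using additive_subgroup.a_subset[OF asub]
        by (intro additive_subgroup.intro LM.add.generate_is_subgroup) auto
      fix x assume "x \<in> ?L"
      then obtain n s where n: "n \<in> N" "s \<in> S" "x = frac n s" by (auto simp: loc_submodule_def)
      obtain k where k: "k \<in> carrier G" "s \<in> \<R> k" using S_degree n(2) .
      from M.direct_sum_finite_sum[OF dir n(1)] obtain F f where
        f: "finite F" "F \<subseteq> carrier G" "f \<in> Pi F (\<lambda>g. N \<inter> \<M> g)" "n = finsum M f F" .
      have "frac (f i) s \<in> ?H" if "i \<in> F" for i
      proof (rule generate.incl)
        have "frac (f i) s \<in> ?L \<inter> LMg (inv\<^bsub>G\<^esub> k \<otimes>\<^bsub>G\<^esub> i)"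
          using f that k n by (intro IntI loc_submoduleI frac_mem_LMg) auto
        then show "frac (f i) s \<in> (\<Union>g\<in>carrier G. ?L \<inter> LMg g)"
          using f that k by (intro UN_I[of "inv\<^bsub>G\<^esub> k \<otimes>\<^bsub>G\<^esub> i"]) auto
      qed
      then have "finsum LM (\<lambda>i. frac (f i) s) F \<in> ?H"
        by (intro H.finsum_mem LM.abelian_group_axioms) auto
      moreover have "f \<in> F \<rightarrow> carrier M" using f component_carrier by blast
      ultimately show "x \<in> ?H"
        using n f by (simp add: finsum_frac)
    qed
  qed
  with subL show ?thesis by (simp add: graded_submodule_def)
qed

text \<open>The map \<open>m \<mapsto> m/1\<close> shifts degrees by the inverse of a fixed degree of \<open>1\<close>, hence injectively.\<close>

lemma contraction_graded_submodule:
  assumes Q: "graded_submodule G LR LM LMg Q"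
  shows "graded_submodule G R M \<M> {m \<in> carrier M. frac m \<one>\<^bsub>R\<^esub> \<in> Q}" (is "graded_submodule _ _ _ _ ?C")
proof (rule graded_submoduleI)
  interpret Q: submodule Q LR LM using Q by (simp add: graded_submodule_def)
  interpret Qa: additive_subgroup Q LM by (rule additive_subgroup.intro, rule Q.subgroup_axioms)
  show "submodule ?C R M"
  proof (rule submoduleI)
    fix a assume "a \<in> ?C"
    then show "\<ominus>\<^bsub>M\<^esub> a \<in> ?C"
      using Qa.a_inv_closed[of "frac a \<one>\<^bsub>R\<^esub>"] LM.abelian_group_axioms by (auto simp: a_inv_frac)
  next
    fix a b assume "a \<in> ?C" "b \<in> ?C"
    then show "a \<oplus>\<^bsub>M\<^esub> b \<in> ?C"
      using Qa.a_closed[of "frac a \<one>\<^bsub>R\<^esub>" "frac b \<one>\<^bsub>R\<^esub>"] by (auto simp: add_frac_same)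
  next
    fix a x assume "a \<in> carrier R" "x \<in> ?C"
    then show "a \<odot>\<^bsub>M\<^esub> x \<in> ?C"
      using Q.smult_closed[of "rfrac a \<one>\<^bsub>R\<^esub>" "frac x \<one>\<^bsub>R\<^esub>"] by (auto simp: smult_frac)
  next
    show "\<zero>\<^bsub>M\<^esub> \<in> ?C"
      using Qa.zero_closed unfolding zero_LM[OF S_one] by blast
    show "?C \<subseteq> carrier M" by blast
  qed
  obtain k where k: "k \<in> carrier G" "\<one>\<^bsub>R\<^esub> \<in> \<R> k" using S_degree[OF S_one] .
  show "homogeneous_closed M (carrier G) \<M> ?C"
  proof (rule homogeneous_closed_vimage[OF M.abelian_group_axioms LM.abelian_group_axioms frac_one_hom])
    show "homogeneous_closed LM (carrier G) LMg Q"
      using Q LM.is_direct_sum_imp_homogeneous_closed[OF LM_component_subgroup LM_independent]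
      by (simp add: graded_submodule_def)
    show "inj_on (\<lambda>g. inv\<^bsub>G\<^esub> k \<otimes>\<^bsub>G\<^esub> g) (carrier G)" using k by (simp add: inj_on_def)
    show "frac x \<one>\<^bsub>R\<^esub> \<in> LMg (inv\<^bsub>G\<^esub> k \<otimes>\<^bsub>G\<^esub> i)" if "i \<in> carrier G" "x \<in> \<M> i" for i x
      using that k by (intro frac_mem_LMg) auto
    show "\<M> i \<subseteq> carrier M" if "i \<in> carrier G" for i
      using component_carrier[OF that] by blast
    show "(\<lambda>g. inv\<^bsub>G\<^esub> k \<otimes>\<^bsub>G\<^esub> g) ` carrier G \<subseteq> carrier G" using k by auto
  qed
qed

lemma LRg_eq: "LRg = loc_module_grading G \<R> S (ring_as_module R) \<R>"
  by (intro ext) (simp add: loc_ring_grading_def loc_module_grading_def module_frac_ring_as_module)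

lemma ring_as_module_localization: "graded_localization G R \<R> (ring_as_module R) \<R> S"
  by (intro graded_localization.intro graded_localization_axioms.intro module_localization.intro
      module_localization_axioms.intro graded_module_ring_as_module R.module_ring_as_module
      S_submonoid S_homogeneous zero_notin_S)

lemma ring_as_module_module_localization: "module_localization R (ring_as_module R) S"
  using ring_as_module_localization by (rule graded_localization.axioms(2))

lemma homogeneous_LR_iff:
  "x \<in> homogeneous G LRg \<longleftrightarrow> (\<exists>r\<in>homogeneous G \<R>. \<exists>s\<in>S. x = rfrac r s)"
  using graded_localization.homogeneous_LM_iff[OF ring_as_module_localization, of x]
  by (simp add: LRg_eq module_frac_ring_as_module)

lemma mult_rfrac:
  assumes "a \<in> carrier R" "b \<in> carrier R" "s \<in> S" "t \<in> S"
  shows "rfrac a s \<otimes>\<^bsub>LR\<^esub> rfrac b t = rfrac (a \<otimes>\<^bsub>R\<^esub> b) (s \<otimes>\<^bsub>R\<^esub> t)"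
  using module_localization.smult_frac[OF ring_as_module_module_localization, of a b s t] assms
  by (simp add: loc_module_ring_as_module module_frac_ring_as_module)

lemma rfrac_eqI:
  assumes "a \<in> carrier R" "b \<in> carrier R" "s \<in> S" "t \<in> S" "t \<otimes>\<^bsub>R\<^esub> a = s \<otimes>\<^bsub>R\<^esub> b"
  shows "rfrac a s = rfrac b t"
  using module_localization.frac_eqI[OF ring_as_module_module_localization, of a b s t] assms
  by (simp add: module_frac_ring_as_module)

text \<open>The contraction of submodules, for the ring as a module over itself.\<close>

lemma contraction_graded_ideal:
  assumes q: "graded_ideal G LR LRg q"
  shows "graded_ideal G R \<R> {r \<in> carrier R. rfrac r \<one>\<^bsub>R\<^esub> \<in> q}"
proof -
  let ?RM = "ring_as_module R"
  let ?LRM = "loc_module R S ?RM"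
  have id: "ideal q LR" using q by (simp add: graded_ideal_def)
  have "subgroup q (add_monoid LR)"
    using ideal.axioms(1)[OF id] by (simp add: additive_subgroup_def)
  then have "submodule q LR ?LRM"
    using ideal.I_l_closed[OF id]
    by (simp add: submodule_def submodule_axioms_def subgroup_def m_inv_def loc_module_ring_as_module)
  moreover have "is_direct_sum ?LRM (carrier G) (\<lambda>g. q \<inter> LRg g) q"
    using q is_direct_sum_cong_structure[of ?LRM LR "carrier G" "\<lambda>g. q \<inter> LRg g" q]
    by (simp add: graded_ideal_def loc_module_ring_as_module)
  ultimately have "graded_submodule G LR ?LRM (loc_module_grading G \<R> S ?RM \<R>) q"
    by (simp add: graded_submodule_def LRg_eq)
  from graded_localization.contraction_graded_submodule[OF ring_as_module_localization this]
  have *: "graded_submodule G R ?RM \<R> {r \<in> carrier R. rfrac r \<one>\<^bsub>R\<^esub> \<in> q}"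
    (is "graded_submodule _ _ _ _ ?p")
    by (simp add: module_frac_ring_as_module)
  then have sub: "submodule ?p R ?RM" by (simp add: graded_submodule_def)
  have "ideal ?p R"
  proof (rule idealI[OF R.ring_axioms])
    show "subgroup ?p (add_monoid R)"
      using submodule.axioms(1)[OF sub] by (simp add: subgroup_def m_inv_def)
    show l: "x \<otimes>\<^bsub>R\<^esub> a \<in> ?p" if "a \<in> ?p" "x \<in> carrier R" for a x
      using submodule.smult_closed[OF sub that(2,1)] by simp
    show "a \<otimes>\<^bsub>R\<^esub> x \<in> ?p" if "a \<in> ?p" "x \<in> carrier R" for a x
    proof -
      have "a \<otimes>\<^bsub>R\<^esub> x = x \<otimes>\<^bsub>R\<^esub> a" using that by (simp add: R.m_comm)
      then show ?thesis using l[OF that] by (simp only:)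
    qed
  qed
  moreover have "is_direct_sum R (carrier G) (\<lambda>g. ?p \<inter> \<R> g) ?p"
    using * is_direct_sum_cong_structure[of ?RM R "carrier G" "\<lambda>g. ?p \<inter> \<R> g" ?p]
    by (simp add: graded_submodule_def)
  ultimately show ?thesis by (simp add: graded_ideal_def)
qed

end

section \<open>Graded primes under localization\<close>

lemma (in graded_ring) homogeneous_mem_radical:
  assumes I: "\<zero>\<^bsub>R\<^esub> \<in> I" and s: "s \<in> I" "s \<in> homogeneous G \<R>"
  shows "s \<in> graded_ideal_radical G R \<R> I"
proof -
  obtain k where k: "k \<in> carrier G" "s \<in> \<R> k" using s by (auto simp: homogeneous_def)
  let ?x = "\<lambda>g\<in>carrier G. if g = k then s else \<zero>\<^bsub>R\<^esub>"
  have sc: "s \<in> carrier R" using k ring_component_carrier by auto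
  have "finite {g \<in> carrier G. ?x g \<noteq> \<zero>\<^bsub>R\<^esub>}"
    by (rule finite_subset[of _ "{k}"]) auto
  then have fam: "?x \<in> fin_supp_families R (carrier G) \<R>"
    using k additive_subgroup.zero_closed[OF ring_component_subgroup]
    unfolding fin_supp_families_def by auto
  have "family_sum R (carrier G) ?x = finsum R ?x {k}"
    using k sc by (intro R.family_sum_eq_finsum) auto
  also have "\<dots> = s"
    using k sc by (subst R.finsum_insert) auto
  finally have sum: "s = family_sum R (carrier G) ?x" by simp
  have "\<forall>g\<in>carrier G. \<exists>n::nat. n > 0 \<and> ?x g [^]\<^bsub>R\<^esub> n \<in> I"
    using I s sc by (intro ballI exI[of _ 1]) auto
  with fam sum show ?thesis
    unfolding graded_ideal_radical_def by blast
qed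

context graded_localization
begin

lemma module_colon_locI:
  assumes "r \<in> module_colon R M N" "s \<in> S"
  shows "rfrac r s \<in> module_colon LR LM (loc_submodule S M N)"
proof -
  have r: "r \<in> carrier R" "\<And>m. m \<in> carrier M \<Longrightarrow> r \<odot>\<^bsub>M\<^esub> m \<in> N"
    using assms by (auto simp: module_colon_def)
  have "rfrac r s \<odot>\<^bsub>LM\<^esub> x \<in> loc_submodule S M N" if "x \<in> carrier LM" for x
  proof -
    from that obtain m t where "m \<in> carrier M" "t \<in> S" "x = frac m t"
      by (auto simp: carrier_LM_iff)
    with r assms(2) show ?thesis by (simp add: smult_frac loc_submoduleI)
  qed
  with r assms(2) show ?thesis by (simp add: module_colon_def)
qed

lemma rfrac_cancel:
  assumes "r \<in> carrier R" "s \<in> S" "t \<in> S"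
  shows "rfrac (t \<otimes>\<^bsub>R\<^esub> r) (t \<otimes>\<^bsub>R\<^esub> s) = rfrac r s"
  using assms S_carrier by (intro rfrac_eqI) (auto simp: R.m_ac)

text \<open>Properness survives because \<open>m/s\<close> is a multiple of \<open>m/1\<close>: a submodule that contains all
  \<open>m/1\<close> is everything.\<close>

lemma contraction_graded_prime_submodule:
  assumes Q: "graded_prime_submodule G LR LRg LM LMg Q"
  shows "graded_prime_submodule G R \<R> M \<M> {m \<in> carrier M. frac m \<one>\<^bsub>R\<^esub> \<in> Q}" (is "graded_prime_submodule _ _ _ _ _ ?C")
  unfolding graded_prime_submodule_def
proof (intro conjI ballI impI)
  have gr: "graded_submodule G LR LM LMg Q" using Q by (simp add: graded_prime_submodule_def)
  then show "graded_submodule G R M \<M> ?C" by (rule contraction_graded_submodule)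
  interpret Q: submodule Q LR LM using gr by (simp add: graded_submodule_def)
  show "?C \<noteq> carrier M"
  proof
    assume C: "?C = carrier M"
    have "x \<in> Q" if "x \<in> carrier LM" for x
    proof -
      from that obtain m s where m: "m \<in> carrier M" "s \<in> S" "x = frac m s"
        by (auto simp: carrier_LM_iff)
      then have "frac m \<one>\<^bsub>R\<^esub> \<in> Q" using C by blast
      then have "rfrac \<one>\<^bsub>R\<^esub> s \<odot>\<^bsub>LM\<^esub> frac m \<one>\<^bsub>R\<^esub> \<in> Q"
        using m by (intro Q.smult_closed) auto
      then show ?thesis unfolding m(3) frac_as_smult[OF m(1,2)] .
    qed
    then have "Q = carrier LM" using Q.subset by auto
    with Q show False by (simp add: graded_prime_submodule_def)
  qed
  fix r m assume r: "r \<in> homogeneous G \<R>" and m: "m \<in> homogeneous G \<M>" and rm: "r \<odot>\<^bsub>M\<^esub> m \<in> ?C"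
  have c: "r \<in> carrier R" "m \<in> carrier M"
    using r m ring_component_carrier component_carrier by (auto simp: homogeneous_def)
  have "rfrac r \<one>\<^bsub>R\<^esub> \<in> homogeneous G LRg" "frac m \<one>\<^bsub>R\<^esub> \<in> homogeneous G LMg"
    using r m S_one unfolding homogeneous_LR_iff homogeneous_LM_iff by blast+
  moreover have "rfrac r \<one>\<^bsub>R\<^esub> \<odot>\<^bsub>LM\<^esub> frac m \<one>\<^bsub>R\<^esub> \<in> Q"
    using c rm by (simp add: smult_frac)
  ultimately have "rfrac r \<one>\<^bsub>R\<^esub> \<in> module_colon LR LM Q \<or> frac m \<one>\<^bsub>R\<^esub> \<in> Q"
    using Q by (auto simp: graded_prime_submodule_def)
  then show "r \<in> module_colon R M ?C \<or> m \<in> ?C"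
  proof
    assume r': "rfrac r \<one>\<^bsub>R\<^esub> \<in> module_colon LR LM Q"
    have "frac (r \<odot>\<^bsub>M\<^esub> n) \<one>\<^bsub>R\<^esub> \<in> Q" if n: "n \<in> carrier M" for n
    proof -
      have "rfrac r \<one>\<^bsub>R\<^esub> \<odot>\<^bsub>LM\<^esub> frac n \<one>\<^bsub>R\<^esub> \<in> Q"
        using r' n by (auto simp: module_colon_def)
      then show ?thesis using n c by (simp add: smult_frac)
    qed
    then show ?thesis using c by (auto simp: module_colon_def)
  qed (use c in auto)
qed

text \<open>Contraction sends the graded primes over \<open>S\<inverse>N\<close> to graded primes over \<open>N\<close>, so that an
  element of the radical of \<open>N\<close> lies in all of these contractions.\<close>

lemma frac_mem_module_radical:
  assumes N: "N \<subseteq> carrier M" and m: "m \<in> graded_module_radical G R \<R> M \<M> N" "m \<in> carrier M" 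
    and s: "s \<in> S"
  shows "frac m s \<in> graded_module_radical G LR LRg LM LMg (loc_submodule S M N)"
proof -
  have "frac m s \<in> Q"
    if Q: "graded_prime_submodule G LR LRg LM LMg Q" "loc_submodule S M N \<subseteq> Q" for Q
  proof -
    let ?C = "{m \<in> carrier M. frac m \<one>\<^bsub>R\<^esub> \<in> Q}"
    have "N \<subseteq> ?C" using N Q(2) loc_submoduleI[OF _ S_one] by blast
    with contraction_graded_prime_submodule[OF Q(1)] m(1) have "m \<in> ?C"
      unfolding graded_module_radical_def by (auto split: if_splits)
    then have "rfrac \<one>\<^bsub>R\<^esub> s \<odot>\<^bsub>LM\<^esub> frac m \<one>\<^bsub>R\<^esub> \<in> Q"
      using s Q(1) submodule.smult_closed[of Q LR LM "rfrac \<one>\<^bsub>R\<^esub> s"]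
      by (auto simp: graded_prime_submodule_def graded_submodule_def)
    then show ?thesis unfolding frac_as_smult[OF m(2) s] .
  qed
  then show ?thesis
    using m s by (auto simp: graded_module_radical_def)
qed

text \<open>Elements of \<open>S\<close> can be cancelled modulo \<open>P\<close>, so that for such primes membership of a fraction
  depends on the numerator only.  The localized prime, its colon ideal and its properness are all
  read off from this.\<close>

lemma frac_mem_loc_prime_iff:
  assumes P: "graded_prime_submodule G R \<R> M \<M> P" "S \<inter> module_colon R M P = {}"
    and m: "m \<in> carrier M" "s \<in> S"
  shows "frac m s \<in> loc_submodule S M P \<longleftrightarrow> m \<in> P"
proof
  assume "frac m s \<in> loc_submodule S M P"
  then obtain u where "u \<in> S" "u \<odot>\<^bsub>M\<^esub> m \<in> P"
    using P m loc_submodule_iff by (auto simp: graded_prime_submodule_def graded_submodule_def)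
  then show "m \<in> P"
    using graded_prime_submodule_cancel[OF P(1)] P(2) S_homogeneous m by blast
next
  assume "m \<in> P"
  then show "frac m s \<in> loc_submodule S M P" using m by (intro loc_submoduleI)
qed

lemma rfrac_mem_colon_loc_prime_iff:
  assumes P: "graded_prime_submodule G R \<R> M \<M> P" "S \<inter> module_colon R M P = {}"
    and r: "r \<in> carrier R" "s \<in> S"
  shows "rfrac r s \<in> module_colon LR LM (loc_submodule S M P) \<longleftrightarrow> r \<in> module_colon R M P"
proof
  assume *: "rfrac r s \<in> module_colon LR LM (loc_submodule S M P)"
  have "r \<odot>\<^bsub>M\<^esub> m \<in> P" if m: "m \<in> carrier M" for m
  proof -
    have "rfrac r s \<odot>\<^bsub>LM\<^esub> frac m \<one>\<^bsub>R\<^esub> \<in> loc_submodule S M P"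
      using * m by (auto simp: module_colon_def)
    then show ?thesis
      using m r frac_mem_loc_prime_iff[OF P, of "r \<odot>\<^bsub>M\<^esub> m" "s \<otimes>\<^bsub>R\<^esub> \<one>\<^bsub>R\<^esub>"] 
      by (simp add: smult_frac del: R.r_one)
  qed
  with r show "r \<in> module_colon R M P" by (simp add: module_colon_def)
qed (use r module_colon_locI in auto)

lemma loc_graded_prime_submodule:
  assumes P: "graded_prime_submodule G R \<R> M \<M> P" "S \<inter> module_colon R M P = {}"
  shows "graded_prime_submodule G LR LRg LM LMg (loc_submodule S M P)"
  unfolding graded_prime_submodule_def
proof (intro conjI ballI impI)
  have gr: "graded_submodule G R M \<M> P" using P by (simp add: graded_prime_submodule_def)
  then show "graded_submodule G LR LM LMg (loc_submodule S M P)" by (rule loc_graded_submodule)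
  have "P \<noteq> carrier M" "P \<subseteq> carrier M"
    using P gr submoduleE(1) by (auto simp: graded_prime_submodule_def graded_submodule_def)
  then obtain m where m: "m \<in> carrier M" "m \<notin> P" by blast
  then have "frac m \<one>\<^bsub>R\<^esub> \<notin> loc_submodule S M P" by (simp add: frac_mem_loc_prime_iff[OF P])
  then show "loc_submodule S M P \<noteq> carrier LM" using m(1) by (metis S_one frac_closed)
  fix x y assume x: "x \<in> homogeneous G LRg" and y: "y \<in> homogeneous G LMg"
    and xy: "x \<odot>\<^bsub>LM\<^esub> y \<in> loc_submodule S M P"
  obtain r s where r: "r \<in> homogeneous G \<R>" "s \<in> S" "x = rfrac r s"
    using x unfolding homogeneous_LR_iff by blast
  obtain n t where n: "n \<in> homogeneous G \<M>" "t \<in> S" "y = frac n t"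
    using y unfolding homogeneous_LM_iff by blast
  have c: "r \<in> carrier R" "n \<in> carrier M"
    using r n ring_component_carrier component_carrier by (auto simp: homogeneous_def)
  have "r \<odot>\<^bsub>M\<^esub> n \<in> P"
    using xy r n c by (simp add: smult_frac frac_mem_loc_prime_iff[OF P])
  then have "r \<in> module_colon R M P \<or> n \<in> P"
    using P r n by (auto simp: graded_prime_submodule_def)
  then show "x \<in> module_colon LR LM (loc_submodule S M P) \<or> y \<in> loc_submodule S M P"
    using r n module_colon_locI loc_submoduleI by auto
qed

text \<open>Both fractions are multiples of each other, as \<open>s/1\<close> and \<open>1/s\<close> are inverse units.\<close>

lemma rfrac_mem_ideal_iff:
  assumes q: "ideal q LR" and r: "r \<in> carrier R" "s \<in> S"
  shows "rfrac r s \<in> q \<longleftrightarrow> rfrac r \<one>\<^bsub>R\<^esub> \<in> q"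
proof -
  interpret q: ideal q LR by fact
  have "rfrac s \<one>\<^bsub>R\<^esub> \<otimes>\<^bsub>LR\<^esub> rfrac r s = rfrac r \<one>\<^bsub>R\<^esub>"
    using r S_carrier by (simp add: mult_rfrac) (intro rfrac_eqI; simp)
  moreover have "rfrac \<one>\<^bsub>R\<^esub> s \<otimes>\<^bsub>LR\<^esub> rfrac r \<one>\<^bsub>R\<^esub> = rfrac r s"
    using r S_carrier by (simp add: mult_rfrac)
  ultimately show ?thesis
    using q.I_l_closed[of "rfrac r s" "rfrac s \<one>\<^bsub>R\<^esub>"] q.I_l_closed[of "rfrac r \<one>\<^bsub>R\<^esub>" "rfrac \<one>\<^bsub>R\<^esub> s"]
      r S_carrier by auto
qed

lemma contraction_graded_prime_ideal:
  assumes q: "graded_prime_ideal G LR LRg q"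
  shows "graded_prime_ideal G R \<R> {r \<in> carrier R. rfrac r \<one>\<^bsub>R\<^esub> \<in> q}" (is "graded_prime_ideal _ _ _ ?p")
    and "S \<inter> {r \<in> carrier R. rfrac r \<one>\<^bsub>R\<^esub> \<in> q} = {}"
proof -
  have gr: "graded_ideal G LR LRg q" using q by (simp add: graded_prime_ideal_def)
  then have id: "ideal q LR" by (simp add: graded_ideal_def)
  have one: "\<one>\<^bsub>LR\<^esub> = rfrac \<one>\<^bsub>R\<^esub> \<one>\<^bsub>R\<^esub>" by (simp add: loc_ring_def)
  have "rfrac s \<one>\<^bsub>R\<^esub> \<notin> q" if s: "s \<in> S" for s
  proof
    assume "rfrac s \<one>\<^bsub>R\<^esub> \<in> q"
    then have "rfrac s s \<in> q" using rfrac_mem_ideal_iff[OF id _ s, of s] s S_carrier by auto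
    moreover have "rfrac s s = \<one>\<^bsub>LR\<^esub>"
      unfolding one using s S_carrier by (intro rfrac_eqI) auto
    ultimately have "q = carrier LR" using ideal.one_imp_carrier[OF id] by simp
    with q show False by (simp add: graded_prime_ideal_def)
  qed
  then show disj: "S \<inter> ?p = {}" by auto
  show "graded_prime_ideal G R \<R> ?p"
    unfolding graded_prime_ideal_def
  proof (intro conjI ballI impI)
    show "graded_ideal G R \<R> ?p" by (rule contraction_graded_ideal[OF gr])
    show "?p \<noteq> carrier R" using disj S_one by blast
    fix a b assume a: "a \<in> homogeneous G \<R>" and b: "b \<in> homogeneous G \<R>" and ab: "a \<otimes>\<^bsub>R\<^esub> b \<in> ?p"
    have c: "a \<in> carrier R" "b \<in> carrier R"
      using a b ring_component_carrier by (auto simp: homogeneous_def)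
    have "rfrac a \<one>\<^bsub>R\<^esub> \<in> homogeneous G LRg" "rfrac b \<one>\<^bsub>R\<^esub> \<in> homogeneous G LRg"
      using a b S_one unfolding homogeneous_LR_iff by blast+
    moreover have "rfrac a \<one>\<^bsub>R\<^esub> \<otimes>\<^bsub>LR\<^esub> rfrac b \<one>\<^bsub>R\<^esub> \<in> q"
      using ab c by (simp add: mult_rfrac)
    ultimately have "rfrac a \<one>\<^bsub>R\<^esub> \<in> q \<or> rfrac b \<one>\<^bsub>R\<^esub> \<in> q"
      using q by (auto simp: graded_prime_ideal_def)
    then show "a \<in> ?p \<or> b \<in> ?p" using c by auto
  qed
qed

text \<open>Contract the given \<open>q\<close> to \<open>p\<close>, take a graded prime \<open>P\<close> over \<open>N\<close> with colon ideal \<open>p\<close>,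
  and localize it again.  Since \<open>p\<close> avoids \<open>S\<close>, the colon ideal of \<open>S\<inverse>P\<close> is \<open>S\<inverse>p = q\<close>.\<close>

lemma loc_primeful:
  assumes N: "graded_submodule G R M \<M> N" and pf: "gr_primeful G R \<R> M \<M> N"
  shows "gr_primeful G LR LRg LM LMg (loc_submodule S M N)"
  unfolding gr_primeful_def
proof (intro allI impI, elim conjE)
  fix q assume q: "graded_prime_ideal G LR LRg q" and Nq: "module_colon LR LM (loc_submodule S M N) \<subseteq> q"
  let ?p = "{r \<in> carrier R. rfrac r \<one>\<^bsub>R\<^esub> \<in> q}"
  have id: "ideal q LR" using q by (simp add: graded_prime_ideal_def graded_ideal_def)
  have "module_colon R M N \<subseteq> ?p"
    using Nq module_colon_locI[OF _ S_one] by (auto simp: module_colon_def)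
  then obtain P where P: "graded_prime_submodule G R \<R> M \<M> P" "N \<subseteq> P" "module_colon R M P = ?p"
    using pf contraction_graded_prime_ideal(1)[OF q] unfolding gr_primeful_def by blast
  have disj: "S \<inter> module_colon R M P = {}"
    unfolding P(3) by (rule contraction_graded_prime_ideal(2)[OF q])
  have "x \<in> module_colon LR LM (loc_submodule S M P) \<longleftrightarrow> x \<in> q" for x
  proof (cases "x \<in> carrier LR")
    case True
    then obtain r s where r: "r \<in> carrier R" "s \<in> S" "x = rfrac r s" by (auto simp: carrier_LR_iff)
    then show ?thesis
      using rfrac_mem_colon_loc_prime_iff[OF P(1) disj r(1,2)] rfrac_mem_ideal_iff[OF id r(1,2)] P(3)
      by auto
  next
    case False
    then show ?thesis
      using additive_subgroup.a_subset[OF ideal.axioms(1)[OF id]] by (auto simp: module_colon_def)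
  qed
  then have "module_colon LR LM (loc_submodule S M P) = q" by blast
  moreover have "loc_submodule S M N \<subseteq> loc_submodule S M P"
    using P(2) by (auto simp: loc_submodule_def)
  ultimately show "\<exists>P. graded_prime_submodule G LR LRg LM LMg P \<and> loc_submodule S M N \<subseteq> P \<and> module_colon LR LM P = q"
    using loc_graded_prime_submodule[OF P(1) disj] by blast
qed

text \<open>Some graded prime ideal over \<open>(N : M)\<close> avoids \<open>S\<close>; the primeful property turns it into a
  graded prime submodule over \<open>N\<close> whose localization is proper.\<close>

lemma loc_proper:
  assumes N: "graded_submodule G R M \<M> N" and pf: "gr_primeful G R \<R> M \<M> N"
    and disj: "S \<inter> module_colon R M N = {}"
  shows "loc_submodule S M N \<noteq> carrier LM"
proof -
  obtain p where p: "graded_prime_ideal G R \<R> p" "module_colon R M N \<subseteq> p" "S \<inter> p = {}"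
    using exists_graded_prime_ideal_avoiding[OF module_colon_graded_ideal[OF N] S_submonoid disj] .
  then obtain P where P: "graded_prime_submodule G R \<R> M \<M> P" "N \<subseteq> P" "module_colon R M P = p"
    using pf unfolding gr_primeful_def by blast
  have "graded_prime_submodule G LR LRg LM LMg (loc_submodule S M P)"
    using loc_graded_prime_submodule[OF P(1)] P p by simp
  then have "loc_submodule S M P \<noteq> carrier LM" "loc_submodule S M P \<subseteq> carrier LM"
    by (auto simp: graded_prime_submodule_def graded_submodule_def submodule_def dest!: subgroup.subset)
  moreover have "loc_submodule S M N \<subseteq> loc_submodule S M P"
    using P(2) by (auto simp: loc_submodule_def)
  ultimately show ?thesis by blast
qed

text \<open>A product of homogeneous fractions in \<open>S\<inverse>N\<close> gives \<open>(ur)m \<in> N\<close> for some \<open>u \<in> S\<close>.  The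
  extra factor is harmless, since \<open>r/s = (ur)/(us)\<close>.\<close>

lemma loc_primary_like:
  assumes N: "graded_primary_like_submodule G R \<R> M \<M> N" and pf: "gr_primeful G R \<R> M \<M> N"
    and disj: "S \<inter> module_colon R M N = {}"
  shows "graded_primary_like_submodule G LR LRg LM LMg (loc_submodule S M N)"
  unfolding graded_primary_like_submodule_def
proof (intro conjI ballI impI)
  have gr: "graded_submodule G R M \<M> N" using N by (simp add: graded_primary_like_submodule_def)
  then have sub: "submodule N R M" by (simp add: graded_submodule_def)
  show "graded_submodule G LR LM LMg (loc_submodule S M N)" by (rule loc_graded_submodule[OF gr])
  show "loc_submodule S M N \<noteq> carrier LM" by (rule loc_proper[OF gr pf disj])
  fix x y assume x: "x \<in> homogeneous G LRg" and y: "y \<in> homogeneous G LMg"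
    and xy: "x \<odot>\<^bsub>LM\<^esub> y \<in> loc_submodule S M N"
  obtain r s where r: "r \<in> homogeneous G \<R>" "s \<in> S" "x = rfrac r s"
    using x unfolding homogeneous_LR_iff by blast
  obtain m t where m: "m \<in> homogeneous G \<M>" "t \<in> S" "y = frac m t"
    using y unfolding homogeneous_LM_iff by blast
  have c: "r \<in> carrier R" "m \<in> carrier M"
    using r m ring_component_carrier component_carrier by (auto simp: homogeneous_def)
  have "frac (r \<odot>\<^bsub>M\<^esub> m) (s \<otimes>\<^bsub>R\<^esub> t) \<in> loc_submodule S M N"
    using xy r m c by (simp add: smult_frac)
  then obtain u where u: "u \<in> S" "u \<odot>\<^bsub>M\<^esub> (r \<odot>\<^bsub>M\<^esub> m) \<in> N"
    using loc_submodule_iff[OF sub] r m c by auto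
  have "(u \<otimes>\<^bsub>R\<^esub> r) \<odot>\<^bsub>M\<^esub> m \<in> N" using u c S_carrier by (simp add: smult_assoc1)
  moreover have "u \<otimes>\<^bsub>R\<^esub> r \<in> homogeneous G \<R>"
  proof -
    obtain k where "k \<in> carrier G" "u \<in> \<R> k" using S_degree u(1) .
    moreover obtain h where "h \<in> carrier G" "r \<in> \<R> h" using r(1) by (auto simp: homogeneous_def)
    ultimately show ?thesis using mult_degree unfolding homogeneous_def by blast
  qed
  ultimately have "u \<otimes>\<^bsub>R\<^esub> r \<in> module_colon R M N \<or> m \<in> graded_module_radical G R \<R> M \<M> N"
    using N m(1) by (auto simp: graded_primary_like_submodule_def)
  then show "x \<in> module_colon LR LM (loc_submodule S M N) \<or>
    y \<in> graded_module_radical G LR LRg LM LMg (loc_submodule S M N)"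
  proof
    assume "u \<otimes>\<^bsub>R\<^esub> r \<in> module_colon R M N"
    then have "rfrac (u \<otimes>\<^bsub>R\<^esub> r) (u \<otimes>\<^bsub>R\<^esub> s) \<in> module_colon LR LM (loc_submodule S M N)"
      using u r by (intro module_colon_locI) auto
    then show ?thesis using rfrac_cancel[OF c(1) r(2) u(1)] r(3) by simp
  next
    assume "m \<in> graded_module_radical G R \<R> M \<M> N"
    then show ?thesis
      using frac_mem_module_radical[OF submoduleE(1)[OF sub]] c m by blast
  qed
qed

end

theorem theorem4p13:
  fixes G :: "('g, 'x) monoid_scheme"
    and R :: "('r, 'y) ring_scheme" and \<R> :: "'g \<Rightarrow> 'r set"
    and M :: "('r, 'm, 'z) module_scheme" and \<M> :: "'g \<Rightarrow> 'm set"
    and S :: "'r set" and N :: "'m set"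
  assumes "graded_module G R \<R> M \<M>"
    and "submonoid S R" and "S \<subseteq> homogeneous G \<R>"
    and "graded_primary_like_submodule G R \<R> M \<M> N"
    and "gr_primeful G R \<R> M \<M> N"
    and "S \<inter> graded_ideal_radical G R \<R> (module_colon R M N) = {}"
  shows "graded_primary_like_submodule G (loc_ring R S) (loc_ring_grading G R \<R> S)
           (loc_module R S M) (loc_module_grading G \<R> S M \<M>) (loc_submodule S M N)
       \<and> gr_primeful G (loc_ring R S) (loc_ring_grading G R \<R> S)
           (loc_module R S M) (loc_module_grading G \<R> S M \<M>) (loc_submodule S M N)"
proof -
  interpret graded_module G R \<R> M \<M> by fact
  have N: "graded_submodule G R M \<M> N"
    using assms(4) by (simp add: graded_primary_like_submodule_def)
  have "ideal (module_colon R M N) R"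
    using module_colon_graded_ideal[OF N] by (simp add: graded_ideal_def)
  then have zero: "\<zero>\<^bsub>R\<^esub> \<in> module_colon R M N"
    by (intro additive_subgroup.zero_closed ideal.axioms(1))
  \<comment> \<open>a homogeneous element of \<open>(N : M)\<close> is its own only component, hence lies in the radical\<close>
  then have disj: "S \<inter> module_colon R M N = {}"
    using homogeneous_mem_radical assms(3,6) by blast
  have "graded_localization G R \<R> M \<M> S"
    using assms(2,3) disj zero
    by (intro graded_localization.intro graded_localization_axioms.intro module_localization.intro
        module_localization_axioms.intro assms(1) module_axioms) auto
  then interpret graded_localization G R \<R> M \<M> S .
  show ?thesis
    using loc_primary_like[OF assms(4,5) disj] loc_primeful[OF N assms(5)] by blast
qed

end
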